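(* Let $k\geq 1$ and let $\mathcal{M}_{\ell\geqslant k}=\bigcup_{\ell\geqslant k}\mathcal{M}_{\ell,k}$ (disjoint union) be the set of over-determined matrices, with its Zariski topology. The behavior of a generic matrix in $\mathcal{M}_{\ell\geqslant k}$ is uncontrollable: the set of $P(\partial)\in\mathcal{M}_{\ell\geqslant k}$ with $\mathfrak{i}_k\neq 0$ is Zariski open, with nonempty intersection with each $\mathcal{M}_{\ell,k}$, $\ell\geqslant k$, and the behavior (the kernel of $P(\partial):\mathcal{F}^k\to\mathcal{F}^\ell$, where $\mathcal{F}=\mathcal{D}'$ or $\mathcal{C}^\infty$) of every such $P(\partial)$ is uncontrollable. In particular, the behavior of a generic square matrix (i.e. $\ell=k$) is uncontrollable.
   Context: $\mathcal{A}=\mathbb{C}[\partial_1,\ldots,\partial_n]$, $n\geq 1$, is the (commutative polynomial) ring of constant coefficient partial differential operators on $\mathbb{R}^n$; $\mathcal{F}$ is the $\mathcal{A}$-module of complex-valued distributions $\mathcal{D}'$ or smooth functions $\mathcal{C}^\infty$ on $\mathbb{R}^n$. A behavior is the kernel in $\mathcal{F}^k$ of some matrix over $\mathcal{A}$ with $k$ columns. It is controllable if, given any two subsets $U_1,U_2$ of $\mathbb{R}^n$ whose closures do not intersect and any $f_1,f_2$ in the behavior, there is an $f$ in the behavior such that $f=f_1$ on some neighborhood of $U_1$ and $f=f_2$ on some neighborhood of $U_2$. A sub-behavior is a behavior in $\mathcal{F}^k$ contained in the given one. A behavior is uncontrollable if it does not contain any nonzero controllable sub-behavior. For an $\ell\times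 k$ matrix $P(\partial)$ over $\mathcal{A}$, $\mathfrak{i}_k$ is the ideal of $\mathcal{A}$ generated by its $k\times k$ minors. $\mathcal{M}_{\ell,k}$ is the set of $\ell\times k$ matrices with entries in $\mathcal{A}$, and $\mathcal{M}_{\ell,k}(d)$ the subset of matrices all of whose entries have degree at most $d$. By taking coefficients, $\mathcal{M}_{\ell,k}(d)$ is identified with $\mathbb{C}^{N(d)}$, $N(d)=\ell k\binom{n+d}{n}$, with its Zariski topology. $\mathcal{M}_{\ell,k}$ carries the direct limit topology (also called Zariski): a subset is open if and only if its intersection with each $\mathcal{M}_{\ell,k}(d)$ is Zariski open in $\mathcal{M}_{\ell,k}(d)$. Disjoint unions carry the disjoint union topology. *)

theory Defs
  imports
    "HOL-Analysis.Analysis"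
    "HOL-Library.Poly_Mapping"
    "HOL-Library.Function_Algebras"
    "Jordan_Normal_Form.Determinant"
    "Jordan_Normal_Form.DL_Submatrix"
begin

section \<open>Polynomials in several variables\<close>

text \<open>
  A polynomial with variables in \<open>'v\<close> is a finitely supported map from exponents
  \<open>'v \<Rightarrow>\<^sub>0 nat\<close> to coefficients, with the convolution product of
  \<open>HOL-Library.Poly_Mapping\<close>.
\<close>

type_synonym 'v mpoly = "('v \<Rightarrow>\<^sub>0 nat) \<Rightarrow>\<^sub>0 complex"

definition mpoly_vars :: "'v mpoly \<Rightarrow> 'v set" where
  "mpoly_vars q = (\<Union>m\<in>Poly_Mapping.keys q. Poly_Mapping.keys m)"

definition monom_eval :: "('v \<Rightarrow>\<^sub>0 nat) \<Rightarrow> ('v \<Rightarrow> complex) \<Rightarrow> complex" where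
  "monom_eval m x = (\<Prod>v\<in>Poly_Mapping.keys m. x v ^ Poly_Mapping.lookup m v)"

definition mpoly_eval :: "'v mpoly \<Rightarrow> ('v \<Rightarrow> complex) \<Rightarrow> complex" where
  "mpoly_eval q x = (\<Sum>m\<in>Poly_Mapping.keys q. Poly_Mapping.lookup q m * monom_eval m x)"

lemma monom_eval_superset:
  assumes "finite V" "Poly_Mapping.keys m \<subseteq> V"
  shows "monom_eval m x = (\<Prod>v\<in>V. x v ^ Poly_Mapping.lookup m v)"
  unfolding monom_eval_def
  by (rule prod.mono_neutral_left) (use assms in \<open>auto simp: in_keys_iff\<close>)

lemma monom_eval_0 [simp]: "monom_eval 0 x = 1"
  by (simp add: monom_eval_def)

lemma monom_eval_add: "monom_eval (m + m') x = monom_eval m x * monom_eval m' x"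
proof -
  let ?V = "Poly_Mapping.keys m \<union> Poly_Mapping.keys m'"
  have "Poly_Mapping.keys (m + m') \<subseteq> ?V"
    by (rule Poly_Mapping.keys_add)
  then show ?thesis
    by (simp add: monom_eval_superset[of ?V] lookup_add power_add prod.distrib)
qed

lemma mpoly_eval_superset:
  assumes "finite M" "Poly_Mapping.keys q \<subseteq> M"
  shows "mpoly_eval q x = (\<Sum>m\<in>M. Poly_Mapping.lookup q m * monom_eval m x)"
  unfolding mpoly_eval_def
  by (rule sum.mono_neutral_left) (use assms in \<open>auto simp: in_keys_iff\<close>)

lemma mpoly_eval_0 [simp]: "mpoly_eval 0 x = 0"
  by (simp add: mpoly_eval_def)

lemma mpoly_eval_single: "mpoly_eval (Poly_Mapping.single m c) x = c * monom_eval m x"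
  by (simp add: mpoly_eval_superset[of "{m}"])

lemma mpoly_eval_1 [simp]: "mpoly_eval 1 x = 1"
  using mpoly_eval_single[of 0 1 x] by simp

lemma mpoly_eval_add: "mpoly_eval (p + q) x = mpoly_eval p x + mpoly_eval q x"
proof -
  let ?M = "Poly_Mapping.keys p \<union> Poly_Mapping.keys q"
  have "Poly_Mapping.keys (p + q) \<subseteq> ?M"
    by (rule Poly_Mapping.keys_add)
  then show ?thesis
    by (simp add: mpoly_eval_superset[of ?M] lookup_add distrib_right sum.distrib)
qed

lemma mpoly_eval_sum: "mpoly_eval (\<Sum>a\<in>A. f a) x = (\<Sum>a\<in>A. mpoly_eval (f a) x)"
  by (induction A rule: infinite_finite_induct) (simp_all add: mpoly_eval_add)

lemma mpoly_sum_single: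
  "q = (\<Sum>m\<in>Poly_Mapping.keys q. Poly_Mapping.single m (Poly_Mapping.lookup q m))"
  by (rule poly_mapping_eqI)
     (auto simp: lookup_sum lookup_single when_def in_keys_iff if_distrib)

lemma mpoly_eval_mult: "mpoly_eval (p * q) x = mpoly_eval p x * mpoly_eval q x"
proof -
  let ?s = "\<lambda>r m. Poly_Mapping.single m (Poly_Mapping.lookup r m)"
  have "p * q = (\<Sum>m\<in>Poly_Mapping.keys p. ?s p m) * (\<Sum>m\<in>Poly_Mapping.keys q. ?s q m)"
    using mpoly_sum_single[of p] mpoly_sum_single[of q] by metis
  also have "\<dots> = (\<Sum>m\<in>Poly_Mapping.keys p. \<Sum>m'\<in>Poly_Mapping.keys q.
      Poly_Mapping.single (m + m') (Poly_Mapping.lookup p m * Poly_Mapping.lookup q m'))"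
    unfolding sum_product mult_single ..
  finally have "mpoly_eval (p * q) x = (\<Sum>m\<in>Poly_Mapping.keys p. \<Sum>m'\<in>Poly_Mapping.keys q.
      (Poly_Mapping.lookup p m * monom_eval m x) * (Poly_Mapping.lookup q m' * monom_eval m' x))"
    by (simp add: mpoly_eval_sum mpoly_eval_single monom_eval_add mult.assoc mult.left_commute)
  then show ?thesis
    unfolding mpoly_eval_def[of p] mpoly_eval_def[of q] sum_product .
qed

lemma mpoly_vars_mult: "mpoly_vars (p * q) \<subseteq> mpoly_vars p \<union> mpoly_vars q"
proof
  fix v assume "v \<in> mpoly_vars (p * q)"
  then obtain m where m: "m \<in> Poly_Mapping.keys (p * q)" "v \<in> Poly_Mapping.keys m"
    by (auto simp: mpoly_vars_def)
  then obtain a b where "m = a + b" "a \<in> Poly_Mapping.keys p" "b \<in> Poly_Mapping.keys q"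
    using keys_mult[of p q] by blast
  then show "v \<in> mpoly_vars p \<union> mpoly_vars q"
    using m(2) Poly_Mapping.keys_add[of a b] by (auto simp: mpoly_vars_def)
qed


section \<open>The Zariski topology on matrices of differential operators\<close>

text \<open>The affine space with coordinates \<open>I\<close> is \<open>I \<rightarrow>\<^sub>E UNIV\<close>.\<close>

definition zero_locus :: "'v set \<Rightarrow> 'v mpoly set \<Rightarrow> ('v \<Rightarrow> complex) set" where
  "zero_locus I S = {x \<in> I \<rightarrow>\<^sub>E UNIV. \<forall>q\<in>S. mpoly_eval q x = 0}"

definition zariski_closed :: "'v set \<Rightarrow> ('v \<Rightarrow> complex) set \<Rightarrow> bool" where
  "zariski_closed I Z \<longleftrightarrow> (\<exists>S. (\<forall>q\<in>S. mpoly_vars q \<subseteq> I) \<and> Z = zero_locus I S)"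

definition affine_zariski :: "'v set \<Rightarrow> ('v \<Rightarrow> complex) topology" where
  "affine_zariski I =
     topology (\<lambda>U. U \<subseteq> I \<rightarrow>\<^sub>E UNIV \<and> zariski_closed I ((I \<rightarrow>\<^sub>E UNIV) - U))"

lemma zariski_closed_Un:
  assumes "zariski_closed I Z" "zariski_closed I Z'"
  shows "zariski_closed I (Z \<union> Z')"
proof -
  obtain S where S: "\<forall>q\<in>S. mpoly_vars q \<subseteq> I" "Z = zero_locus I S"
    using assms(1) unfolding zariski_closed_def by (elim exE conjE)
  obtain S' where S': "\<forall>q\<in>S'. mpoly_vars q \<subseteq> I" "Z' = zero_locus I S'"
    using assms(2) unfolding zariski_closed_def by (elim exE conjE)
  let ?T = "{p * q | p q. p \<in> S \<and> q \<in> S'}"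
  have "\<forall>r\<in>?T. mpoly_vars r \<subseteq> I"
  proof
    fix r assume "r \<in> ?T"
    then obtain p q where "r = p * q" "p \<in> S" "q \<in> S'"
      by (elim CollectE exE conjE)
    moreover from this have "mpoly_vars p \<subseteq> I" "mpoly_vars q \<subseteq> I"
      using S(1) S'(1) by simp_all
    ultimately show "mpoly_vars r \<subseteq> I"
      using mpoly_vars_mult[of p q] by auto
  qed
  moreover have "Z \<union> Z' = zero_locus I ?T"
  proof (intro Set.set_eqI iffI)
    fix x assume "x \<in> Z \<union> Z'"
    then show "x \<in> zero_locus I ?T"
      unfolding S(2) S'(2) zero_locus_def by (auto simp: mpoly_eval_mult)
  next
    fix x assume x: "x \<in> zero_locus I ?T"
    show "x \<in> Z \<union> Z'"
    proof (rule ccontr)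
      assume "x \<notin> Z \<union> Z'"
      then obtain p q where pq: "p \<in> S" "q \<in> S'" "mpoly_eval p x \<noteq> 0" "mpoly_eval q x \<noteq> 0"
        using x unfolding S(2) S'(2) zero_locus_def by blast
      then have "p * q \<in> ?T"
        by blast
      then have "mpoly_eval (p * q) x = 0"
        using x unfolding zero_locus_def by blast
      then show False
        using pq by (simp add: mpoly_eval_mult)
    qed
  qed
  ultimately show ?thesis
    unfolding zariski_closed_def by blast
qed

lemma zariski_closed_Inter:
  assumes "\<And>Z. Z \<in> \<Z> \<Longrightarrow> zariski_closed I Z"
  shows "zariski_closed I ((I \<rightarrow>\<^sub>E UNIV) \<inter> \<Inter>\<Z>)"
proof -
  let ?T = "{q. mpoly_vars q \<subseteq> I \<and> (\<exists>Z\<in>\<Z>. \<forall>x\<in>Z. mpoly_eval q x = 0)}"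
  have "(I \<rightarrow>\<^sub>E UNIV) \<inter> \<Inter>\<Z> = zero_locus I ?T"
  proof (intro equalityI subsetI)
    fix x assume "x \<in> (I \<rightarrow>\<^sub>E UNIV) \<inter> \<Inter>\<Z>"
    then show "x \<in> zero_locus I ?T"
      by (auto simp: zero_locus_def)
  next
    fix x assume x: "x \<in> zero_locus I ?T"
    have "x \<in> Z" if Z: "Z \<in> \<Z>" for Z
    proof -
      obtain S where S: "\<forall>q\<in>S. mpoly_vars q \<subseteq> I" "Z = zero_locus I S"
        using assms[OF Z] unfolding zariski_closed_def by (elim exE conjE)
      have "S \<subseteq> ?T"
      proof
        fix q assume q: "q \<in> S"
        then have "\<forall>x\<in>Z. mpoly_eval q x = 0"
          unfolding S(2) by (simp add: zero_locus_def)
        then show "q \<in> ?T"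
          using S(1) Z q by auto
      qed
      then show ?thesis
        using x subsetD unfolding S(2) zero_locus_def by fast
    qed
    then show "x \<in> (I \<rightarrow>\<^sub>E UNIV) \<inter> \<Inter>\<Z>"
      using x by (auto simp: zero_locus_def)
  qed
  moreover have "\<forall>q\<in>?T. mpoly_vars q \<subseteq> I"
    by simp
  ultimately show ?thesis
    unfolding zariski_closed_def by (intro exI[of _ ?T] conjI)
qed

lemma istopology_affine_zariski:
  "istopology (\<lambda>U. U \<subseteq> I \<rightarrow>\<^sub>E UNIV \<and> zariski_closed I ((I \<rightarrow>\<^sub>E UNIV) - U))"
  unfolding istopology_def
proof (intro conjI allI impI)
  fix U V
  assume *: "U \<subseteq> I \<rightarrow>\<^sub>E UNIV \<and> zariski_closed I ((I \<rightarrow>\<^sub>E UNIV) - U)"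
    and **: "V \<subseteq> I \<rightarrow>\<^sub>E UNIV \<and> zariski_closed I ((I \<rightarrow>\<^sub>E UNIV) - V)"
  show "U \<inter> V \<subseteq> I \<rightarrow>\<^sub>E UNIV" using * by blast
  show "zariski_closed I ((I \<rightarrow>\<^sub>E UNIV) - U \<inter> V)"
    unfolding Diff_Int using * ** by (blast intro: zariski_closed_Un)
next
  fix \<K>
  assume *: "\<forall>U\<in>\<K>. U \<subseteq> I \<rightarrow>\<^sub>E UNIV \<and> zariski_closed I ((I \<rightarrow>\<^sub>E UNIV) - U)"
  show "\<Union>\<K> \<subseteq> I \<rightarrow>\<^sub>E UNIV" using * by blast
  have eq: "E - \<Union>\<K> = E \<inter> \<Inter>((\<lambda>U. E - U) ` \<K>)" for E :: "('a \<Rightarrow> complex) set"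
    by blast
  show "zariski_closed I ((I \<rightarrow>\<^sub>E UNIV) - \<Union>\<K>)"
    unfolding eq
  proof (rule zariski_closed_Inter)
    fix Z assume "Z \<in> (\<lambda>U. (I \<rightarrow>\<^sub>E UNIV) - U) ` \<K>"
    then obtain U where "U \<in> \<K>" "Z = (I \<rightarrow>\<^sub>E UNIV) - U"
      by (elim imageE)
    then show "zariski_closed I Z"
      using * by simp
  qed
qed

lemma openin_affine_zariski:
  "openin (affine_zariski I) U \<longleftrightarrow>
     U \<subseteq> I \<rightarrow>\<^sub>E UNIV \<and> zariski_closed I ((I \<rightarrow>\<^sub>E UNIV) - U)"
  unfolding affine_zariski_def by (simp add: istopology_affine_zariski)

lemma topspace_affine_zariski [simp]: "topspace (affine_zariski I) = I \<rightarrow>\<^sub>E UNIV"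
proof
  show "topspace (affine_zariski I) \<subseteq> I \<rightarrow>\<^sub>E UNIV"
    using openin_affine_zariski openin_topspace by blast
  have "zariski_closed I {}"
    unfolding zariski_closed_def zero_locus_def
    by (rule exI[of _ "{1}"]) (auto simp: mpoly_vars_def)
  then have "openin (affine_zariski I) (I \<rightarrow>\<^sub>E UNIV)"
    by (simp add: openin_affine_zariski)
  then show "I \<rightarrow>\<^sub>E UNIV \<subseteq> topspace (affine_zariski I)"
    by (rule openin_subset)
qed

text \<open>
  \<open>'n diffop\<close> is \<open>\<complex>[\<partial>\<^sub>1, \<dots>, \<partial>\<^sub>n]\<close> with \<open>n = CARD('n)\<close>; the key \<open>\<alpha>\<close> stands
  for \<open>\<partial>\<^sup>\<alpha>\<close>.
\<close>

type_synonym 'n diffop = "'n mpoly"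

definition mi_degree :: "('n::finite \<Rightarrow>\<^sub>0 nat) \<Rightarrow> nat" where
  "mi_degree \<alpha> = (\<Sum>i\<in>UNIV. Poly_Mapping.lookup \<alpha> i)"

definition matrices_upto :: "nat \<Rightarrow> nat \<Rightarrow> nat \<Rightarrow> 'n::finite diffop mat set" where
  "matrices_upto l k d =
     {P \<in> carrier_mat l k. \<forall>i<l. \<forall>j<k. \<forall>\<alpha>\<in>Poly_Mapping.keys (P $$ (i, j)). mi_degree \<alpha> \<le> d}"

text \<open>
  The coefficients of a matrix in \<open>matrices_upto l k d\<close>: position \<open>(i, j)\<close> and exponent.
  There are \<open>l k (n + d choose n)\<close> of them.
\<close>

definition coeff_index :: "nat \<Rightarrow> nat \<Rightarrow> nat \<Rightarrow> (nat \<times> nat \<times> ('n::finite \<Rightarrow>\<^sub>0 nat)) set" where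
  "coeff_index l k d = {(i, j, \<alpha>). i < l \<and> j < k \<and> mi_degree \<alpha> \<le> d}"

definition mat_coeffs ::
    "nat \<Rightarrow> nat \<Rightarrow> nat \<Rightarrow> 'n::finite diffop mat \<Rightarrow> nat \<times> nat \<times> ('n \<Rightarrow>\<^sub>0 nat) \<Rightarrow> complex" where
  "mat_coeffs l k d P =
     restrict (\<lambda>(i, j, \<alpha>). Poly_Mapping.lookup (P $$ (i, j)) \<alpha>) (coeff_index l k d)"

definition zariski_upto :: "nat \<Rightarrow> nat \<Rightarrow> nat \<Rightarrow> 'n::finite diffop mat topology" where
  "zariski_upto l k d =
     pullback_topology (matrices_upto l k d) (mat_coeffs l k d) (affine_zariski (coeff_index l k d))"

definition zariski_matrices :: "nat \<Rightarrow> nat \<Rightarrow> 'n::finite diffop mat topology" where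
  "zariski_matrices l k =
     topology (\<lambda>U. U \<subseteq> carrier_mat l k \<and>
       (\<forall>d. openin (zariski_upto l k d) (U \<inter> matrices_upto l k d)))"

definition zariski_overdetermined :: "nat \<Rightarrow> (nat \<times> 'n::finite diffop mat) topology" where
  "zariski_overdetermined k = sum_topology (\<lambda>l. zariski_matrices l k) {k..}"

lemma topspace_zariski_upto [simp]: "topspace (zariski_upto l k d) = matrices_upto l k d"
  by (auto simp: zariski_upto_def topspace_pullback_topology mat_coeffs_def)

lemma istopology_zariski_matrices:
  "istopology (\<lambda>U. U \<subseteq> carrier_mat l k \<and>
     (\<forall>d. openin (zariski_upto l k d) (U \<inter> matrices_upto l k d)))"
proof -
  let ?M = "matrices_upto l k :: nat \<Rightarrow> 'a diffop mat set"
  show ?thesis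
    unfolding istopology_def
  proof (intro conjI allI impI)
    fix U V d
    assume U: "U \<subseteq> carrier_mat l k \<and> (\<forall>d. openin (zariski_upto l k d) (U \<inter> ?M d))"
      and V: "V \<subseteq> carrier_mat l k \<and> (\<forall>d. openin (zariski_upto l k d) (V \<inter> ?M d))"
    show "U \<inter> V \<subseteq> carrier_mat l k"
      using U by blast
    have "(U \<inter> V) \<inter> ?M d = (U \<inter> ?M d) \<inter> (V \<inter> ?M d)"
      by blast
    then show "openin (zariski_upto l k d) ((U \<inter> V) \<inter> ?M d)"
      using U V by (simp add: openin_Int)
  next
    fix \<K> d
    assume *: "\<forall>U\<in>\<K>. U \<subseteq> carrier_mat l k \<and> (\<forall>d. openin (zariski_upto l k d) (U \<inter> ?M d))"
    show "\<Union>\<K> \<subseteq> carrier_mat l k"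
      using * by blast
    have eq: "\<Union>\<K> \<inter> ?M d = \<Union>((\<lambda>U. U \<inter> ?M d) ` \<K>)"
      by blast
    show "openin (zariski_upto l k d) (\<Union>\<K> \<inter> ?M d)"
      unfolding eq using * by (intro openin_Union) auto
  qed
qed

lemma openin_zariski_matrices:
  "openin (zariski_matrices l k) U \<longleftrightarrow>
     U \<subseteq> carrier_mat l k \<and> (\<forall>d. openin (zariski_upto l k d) (U \<inter> matrices_upto l k d))"
  unfolding zariski_matrices_def by (simp add: istopology_zariski_matrices)

lemma topspace_zariski_matrices [simp]: "topspace (zariski_matrices l k) = carrier_mat l k"
proof
  show "topspace (zariski_matrices l k) \<subseteq> carrier_mat l k"
    using openin_zariski_matrices openin_topspace by blast
  have "carrier_mat l k \<inter> matrices_upto l k d = matrices_upto l k d" for d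
    by (auto simp: matrices_upto_def)
  then have "openin (zariski_matrices l k) (carrier_mat l k)"
    by (metis openin_zariski_matrices order_refl openin_topspace topspace_zariski_upto)
  then show "carrier_mat l k \<subseteq> topspace (zariski_matrices l k)"
    by (rule openin_subset)
qed


section \<open>The ideal of maximal minors\<close>

definition minors :: "nat \<Rightarrow> 'a::comm_ring_1 mat \<Rightarrow> 'a set" where
  "minors r P = {Determinant.det (submatrix P I J) | I J.
     I \<subseteq> {..<dim_row P} \<and> J \<subseteq> {..<dim_col P} \<and> card I = r \<and> card J = r}"

text \<open>Ideals are the submodules of the ring regarded as a module over itself.\<close>

definition minor_ideal :: "nat \<Rightarrow> 'a::comm_ring_1 mat \<Rightarrow> 'a set" where
  "minor_ideal r P = Modules.module.span (*) (minors r P)"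


section \<open>Smooth functions and distributions\<close>

definition partial :: "'n::finite \<Rightarrow> (real^'n \<Rightarrow> complex) \<Rightarrow> real^'n \<Rightarrow> complex" where
  "partial i f = (\<lambda>x. frechet_derivative f (at x) (axis i 1))"

definition smooth :: "(real^'n::finite \<Rightarrow> complex) \<Rightarrow> bool" where
  "smooth f \<longleftrightarrow> (\<forall>is x. foldr partial is f differentiable (at x))"

text \<open>
  For smooth functions partial derivatives commute, so any list in which each \<open>i\<close> occurs
  \<open>\<alpha>\<^sub>i\<close> times yields the same function.
\<close>

definition multi_partial ::
    "('n::finite \<Rightarrow>\<^sub>0 nat) \<Rightarrow> (real^'n \<Rightarrow> complex) \<Rightarrow> real^'n \<Rightarrow> complex" where
  "multi_partial \<alpha> f = foldr partial (SOME is. count_list is = Poly_Mapping.lookup \<alpha>) f"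

definition supp :: "(real^'n::finite \<Rightarrow> complex) \<Rightarrow> (real^'n) set" where
  "supp \<phi> = closure {x. \<phi> x \<noteq> 0}"

definition test_functions :: "(real^'n::finite \<Rightarrow> complex) set" where
  "test_functions = {\<phi>. smooth \<phi> \<and> compact (supp \<phi>)}"

text \<open>
  A distribution is represented by a functional on all functions that vanishes off
  \<open>test_functions\<close>, so that distributions are equal iff they agree on test functions.
\<close>

definition distributions :: "((real^'n::finite \<Rightarrow> complex) \<Rightarrow> complex) set" where
  "distributions = {u.
     (\<forall>\<phi>. \<phi> \<notin> test_functions \<longrightarrow> u \<phi> = 0) \<and>
     (\<forall>\<phi>\<in>test_functions. \<forall>\<psi>\<in>test_functions. u (\<lambda>x. \<phi> x + \<psi> x) = u \<phi> + u \<psi>) \<and>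
     (\<forall>c. \<forall>\<phi>\<in>test_functions. u (\<lambda>x. c * \<phi> x) = c * u \<phi>) \<and>
     (\<forall>K. compact K \<longrightarrow> (\<exists>C N. \<forall>\<phi>\<in>test_functions. supp \<phi> \<subseteq> K \<longrightarrow>
        cmod (u \<phi>) \<le> C * (\<Sum>\<alpha> | mi_degree \<alpha> \<le> N. SUP x. cmod (multi_partial \<alpha> \<phi> x))))}"

text \<open>
  Both function spaces consist of complex-valued functions, on \<open>\<real>\<^sup>n\<close> or on test functions;
  sums and zero are pointwise. \<open>agree S V f g\<close> says that \<open>f\<close> and \<open>g\<close> have the same
  restriction to the open set \<open>V\<close>.
\<close>

record ('n, 'x) signal_space =
  signals :: "('x \<Rightarrow> complex) set"
  act :: "'n diffop \<Rightarrow> ('x \<Rightarrow> complex) \<Rightarrow> 'x \<Rightarrow> complex"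
  agree :: "(real^'n) set \<Rightarrow> ('x \<Rightarrow> complex) \<Rightarrow> ('x \<Rightarrow> complex) \<Rightarrow> bool"

definition smooth_space :: "('n::finite, real^'n) signal_space" where
  "smooth_space = \<lparr>
     signals = {f. smooth f},
     act = (\<lambda>p f x. \<Sum>\<alpha>\<in>Poly_Mapping.keys p. Poly_Mapping.lookup p \<alpha> * multi_partial \<alpha> f x),
     agree = (\<lambda>V f g. \<forall>x\<in>V. f x = g x) \<rparr>"

text \<open>
  \<open>(\<partial>\<^sup>\<alpha> u) \<phi> = (-1)\<^bsup>|\<alpha>|\<^esup> u (\<partial>\<^sup>\<alpha> \<phi>)\<close>. The case distinction is needed because \<open>\<partial>\<^sup>\<alpha> \<phi>\<close> can be a
  test function without \<open>\<phi>\<close> being one.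
\<close>

definition distribution_space :: "('n::finite, real^'n \<Rightarrow> complex) signal_space" where
  "distribution_space = \<lparr>
     signals = distributions,
     act = (\<lambda>p u \<phi>. if \<phi> \<in> test_functions
       then \<Sum>\<alpha>\<in>Poly_Mapping.keys p.
         Poly_Mapping.lookup p \<alpha> * (-1) ^ mi_degree \<alpha> * u (multi_partial \<alpha> \<phi>)
       else 0),
     agree = (\<lambda>V u v. \<forall>\<phi>\<in>test_functions. supp \<phi> \<subseteq> V \<longrightarrow> u \<phi> = v \<phi>) \<rparr>"


section \<open>Behaviors\<close>

definition behavior ::
    "('n::finite, 'x) signal_space \<Rightarrow> 'n diffop mat \<Rightarrow> ('x \<Rightarrow> complex) Matrix.vec set" where
  "behavior S P = {f \<in> carrier_vec (dim_col P).
     (\<forall>j<dim_col P. vec_index f j \<in> signals S) \<and>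
     (\<forall>i<dim_row P. (\<Sum>j<dim_col P. act S (P $$ (i, j)) (vec_index f j)) = 0)}"

definition is_behavior ::
    "('n::finite, 'x) signal_space \<Rightarrow> nat \<Rightarrow> ('x \<Rightarrow> complex) Matrix.vec set \<Rightarrow> bool" where
  "is_behavior S k B \<longleftrightarrow> (\<exists>P. dim_col P = k \<and> B = behavior S P)"

definition equal_near ::
    "('n::finite, 'x) signal_space \<Rightarrow> (real^'n) set \<Rightarrow>
     ('x \<Rightarrow> complex) Matrix.vec \<Rightarrow> ('x \<Rightarrow> complex) Matrix.vec \<Rightarrow> bool" where
  "equal_near S U f g \<longleftrightarrow>
     (\<exists>V. open V \<and> U \<subseteq> V \<and> dim_vec f = dim_vec g \<and>
        (\<forall>j<dim_vec f. agree S V (vec_index f j) (vec_index g j)))"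

definition controllable ::
    "('n::finite, 'x) signal_space \<Rightarrow> ('x \<Rightarrow> complex) Matrix.vec set \<Rightarrow> bool" where
  "controllable S B \<longleftrightarrow>
     (\<forall>U1 U2. closure U1 \<inter> closure U2 = {} \<longrightarrow>
        (\<forall>f1\<in>B. \<forall>f2\<in>B. \<exists>f\<in>B. equal_near S U1 f f1 \<and> equal_near S U2 f f2))"

definition uncontrollable ::
    "('n::finite, 'x) signal_space \<Rightarrow> nat \<Rightarrow> ('x \<Rightarrow> complex) Matrix.vec set \<Rightarrow> bool" where
  "uncontrollable S k B \<longleftrightarrow>
     \<not> (\<exists>C. is_behavior S k C \<and> C \<subseteq> B \<and> C \<noteq> {0\<^sub>v k} \<and> controllable S C)"

end

theory Submission
  imports Defs
begin

text \<open>
  If a controllable sub-behavior contains some \<open>f \<noteq> 0\<close>, then patching \<open>f\<close> on a ball with \<open>0\<close> far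
  away produces an element \<open>g\<close> of the behavior of \<open>P\<close> that has compact support and is not \<open>0\<close>.
  The two-sided Laplace transform turns \<open>P(\<partial>) g = 0\<close> into the linear systems \<open>P(-a) \<gamma>(a) = 0\<close>,
  \<open>a \<in> \<real>\<^sup>n\<close>, where \<open>\<gamma>\<close> is the transform of \<open>g\<close>. Hence \<open>\<gamma>\<close> vanishes wherever some nonzero maximal
  minor does not vanish at \<open>-a\<close>, and then everywhere by continuity; as the exponentials
  \<open>x \<mapsto> exp (a \<bullet> x)\<close> span a dense algebra (Stone-Weierstrass), \<open>g = 0\<close>, a contradiction. For
  distributions the same is applied to the regularizations \<open>x \<mapsto> g (\<phi> (\<cdot> - x))\<close>.

  Openness: a minor vanishes iff all its values do, and these values are polynomials in the
  coefficients of \<open>P\<close>.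
\<close>

section \<open>Polynomials and minors\<close>

text \<open>Of a controllable sub-behavior, only two facts are used: it contains 0, so
  \<open>f\<close> can be patched with 0, and it lies in the behavior of \<open>P\<close>, so the
  patched signal satisfies the equations of \<open>P\<close>. Its own matrix is needed only for the
  first fact. Compact support makes the transform exist for every \<open>a\<close>, whatever the
  growth of the exponential. Real parameters lose nothing, because a nonzero polynomial cannot
  vanish at all real points. They bring a gain over characters: the real span of the functions exp
  (a . x) is an algebra of real functions, so injectivity of the transform follows from density
  alone, without an inversion formula. A distribution is not transformed itself. Its regularization
  is a continuous function of compact support whose value at 0 is \<open>g \<phi>\<close>; only its
  continuity and its derivatives along the axes have to be established. Injectivity also gives the
  symmetry of mixed partial derivatives of test functions, which differentiating the regularization
  requires.\<close>

lemma finite_mi_degree_le: "finite {\<alpha> :: 'n::finite \<Rightarrow>\<^sub>0 nat. mi_degree \<alpha> \<le> d}"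
proof (rule finite_imageD)
  have "Poly_Mapping.lookup \<alpha> i \<le> mi_degree \<alpha>" for \<alpha> :: "'n \<Rightarrow>\<^sub>0 nat" and i
    unfolding mi_degree_def by (rule member_le_sum) auto
  then have "Poly_Mapping.lookup ` {\<alpha> :: 'n \<Rightarrow>\<^sub>0 nat. mi_degree \<alpha> \<le> d} \<subseteq> UNIV \<rightarrow>\<^sub>E {..d}"
    by (auto intro: order_trans)
  then show "finite (Poly_Mapping.lookup ` {\<alpha> :: 'n \<Rightarrow>\<^sub>0 nat. mi_degree \<alpha> \<le> d})"
    by (rule finite_subset) (intro finite_PiE; simp)
  show "inj_on Poly_Mapping.lookup {\<alpha> :: 'n \<Rightarrow>\<^sub>0 nat. mi_degree \<alpha> \<le> d}"
    by (auto intro: inj_onI poly_mapping_eqI)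
qed

lemma monom_eval_UNIV:
  "monom_eval (m :: 'n::finite \<Rightarrow>\<^sub>0 nat) x = (\<Prod>i\<in>UNIV. x i ^ Poly_Mapping.lookup m i)"
  by (rule monom_eval_superset) auto

text \<open>Kronecker's substitution \<open>x\<^sub>i = t ^ (s ^ e i)\<close>: for generic \<open>s\<close> distinct monomials become
  distinct powers of \<open>t\<close>.\<close>

lemma mpoly_real_nonroot:
  fixes q :: "'n::finite mpoly"
  assumes "q \<noteq> 0"
  obtains x :: "real^'n" where "mpoly_eval q (\<lambda>i. of_real (vec_nth x i)) \<noteq> 0"
proof -
  obtain e :: "'n \<Rightarrow> nat" where e: "inj e"
    using finite_imp_inj_to_nat_seg[of "UNIV :: 'n set"] by auto
  \<comment> \<open>As a polynomial in \<open>s\<close>, \<open>pp m m'\<close> is the difference of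
    the powers of \<open>t\<close> that \<open>m\<close> and \<open>m'\<close> become. Injectivity
    of \<open>e\<close> keeps the variables in different degrees, so it is nonzero for distinct
    monomials.\<close>
  define pp where "pp m m' = (\<Sum>i\<in>UNIV. Polynomial.monom
    (int (Poly_Mapping.lookup m i) - int (Poly_Mapping.lookup m' i)) (e i))" for m m' :: "'n \<Rightarrow>\<^sub>0 nat"
  have pp0: "pp m m' \<noteq> 0" if ne: "m \<noteq> m'" for m m'
  proof -
    obtain i where i: "Poly_Mapping.lookup m i \<noteq> Poly_Mapping.lookup m' i"
      using ne by (auto simp: poly_mapping_eq_iff fun_eq_iff)
    have "coeff (pp m m') (e i) = int (Poly_Mapping.lookup m i) - int (Poly_Mapping.lookup m' i)"
      unfolding pp_def coeff_sum using e by (simp add: inj_eq)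
    then show ?thesis using i by auto
  qed
  let ?K = "Poly_Mapping.keys q"
  have "finite (\<Union>m\<in>?K. \<Union>m'\<in>?K - {m}. {s. poly (pp m m') s = 0})"
    by (intro finite_UN_I finite_Diff finite_keys poly_roots_finite pp0) auto
  moreover have "infinite (range int)"
    by (simp add: finite_image_iff)
  ultimately obtain s where s: "int s \<notin> (\<Union>m\<in>?K. \<Union>m'\<in>?K - {m}. {s. poly (pp m m') s = 0})"
    by (meson finite_subset image_subsetI)
  define w where "w m = (\<Sum>i\<in>UNIV. s ^ e i * Poly_Mapping.lookup m i)" for m :: "'n \<Rightarrow>\<^sub>0 nat"
  have "poly (pp m m') (int s) = int (w m) - int (w m')" for m m'
    unfolding pp_def w_def poly_sum poly_monom
    by (simp add: sum_subtractf[symmetric] algebra_simps)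
  then have w: "inj_on w ?K"
    using s by (intro inj_onI) fastforce
  \<comment> \<open>\<open>r\<close> is \<open>q\<close> after the substitution, as a polynomial in
    \<open>t\<close>. Since \<open>w\<close> is injective on the keys, no two terms can
    cancel.\<close>
  define r where "r = (\<Sum>m\<in>?K. Polynomial.monom (Poly_Mapping.lookup q m) (w m))"
  obtain m0 where m0: "m0 \<in> ?K"
    using assms by (meson keys_eq_empty ex_in_conv)
  have "coeff r (w m0) = (\<Sum>m\<in>?K. if m = m0 then Poly_Mapping.lookup q m else 0)"
    unfolding r_def coeff_sum coeff_monom
    by (rule sum.cong) (use w m0 in \<open>auto simp: inj_on_def\<close>)
  then have "coeff r (w m0) \<noteq> 0"
    using m0 by (simp add: in_keys_iff)
  then have "finite {z. poly r z = 0}"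
    by (intro poly_roots_finite) auto
  moreover have "infinite (range complex_of_real)"
    by (simp add: finite_image_iff inj_of_real infinite_UNIV_char_0)
  ultimately obtain t where t: "poly r (complex_of_real t) \<noteq> 0"
    by (metis (mono_tags, lifting) finite_subset image_subsetI mem_Collect_eq)
  have "monom_eval m (\<lambda>i. of_real (vec_nth (\<chi> i. t ^ (s ^ e i)) i)) = of_real t ^ w m" for m :: "'n \<Rightarrow>\<^sub>0 nat"
    by (simp add: monom_eval_UNIV w_def power_sum power_mult)
  then have "mpoly_eval q (\<lambda>i. of_real (vec_nth (\<chi> i. t ^ (s ^ e i)) i)) = poly r (of_real t)"
    unfolding mpoly_eval_def r_def poly_sum poly_monom by simp
  then show ?thesis
    using t that by metis
qed

text \<open>On the line from \<open>a\<close> through a point \<open>x\<close> with nonzero value,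
  \<open>q\<close> is a one-variable polynomial that is nonzero at parameter 1. It has finitely many
  roots, so arbitrarily small parameters avoid them.\<close>

lemma mpoly_nonroots_dense:
  fixes q :: "'n::finite mpoly" and a :: "real^'n"
  assumes "q \<noteq> 0"
  obtains b where "b \<longlonglongrightarrow> a" "\<And>n. mpoly_eval q (\<lambda>i. of_real (vec_nth (b n) i)) \<noteq> 0"
proof -
  obtain x :: "real^'n" where x: "mpoly_eval q (\<lambda>i. of_real (vec_nth x i)) \<noteq> 0"
    using assms by (rule mpoly_real_nonroot)
  define r where "r = (\<Sum>m\<in>Poly_Mapping.keys q. Polynomial.smult (Poly_Mapping.lookup q m)
    (\<Prod>i\<in>UNIV. [:of_real (vec_nth a i), of_real (vec_nth x i - vec_nth a i):] ^ Poly_Mapping.lookup m i))"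
  have r: "poly r (of_real t) = mpoly_eval q (\<lambda>i. of_real (vec_nth (a + t *\<^sub>R (x - a)) i))" for t
    unfolding r_def mpoly_eval_def
    by (simp add: poly_sum poly_prod monom_eval_UNIV)
  have "poly r (of_real 1) \<noteq> 0"
    unfolding r using x by simp
  then have "finite {z. poly r z = 0}"
    by (intro poly_roots_finite) auto
  then have fin: "finite {t::real. poly r (of_real t) = 0}"
    using finite_vimageI[of "{z. poly r z = 0}" complex_of_real] by (simp add: inj_of_real vimage_def)
  have "\<exists>t. 0 < t \<and> t < inverse (real (Suc n)) \<and> poly r (of_real t) \<noteq> 0" for n
  proof (rule ccontr)
    assume "\<not> ?thesis"
    then have "{0<..<inverse (real (Suc n))} \<subseteq> {t::real. poly r (of_real t) = 0}"
      by auto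
    then have "finite {0<..<inverse (real (Suc n))}"
      using fin by (rule finite_subset)
    then show False by (simp add: infinite_Ioo)
  qed
  then obtain t where t: "\<And>n. 0 < t n" "\<And>n. t n < inverse (real (Suc n))"
    "\<And>n. poly r (of_real (t n)) \<noteq> 0"
    by metis
  have "t \<longlonglongrightarrow> 0"
    by (rule tendsto_sandwich[OF _ _ tendsto_const LIMSEQ_inverse_real_of_nat])
       (use t in \<open>auto intro!: always_eventually less_imp_le\<close>)
  then have "(\<lambda>n. a + t n *\<^sub>R (x - a)) \<longlonglongrightarrow> a + 0 *\<^sub>R (x - a)"
    by (intro tendsto_intros)
  then show ?thesis
    using that[of "\<lambda>n. a + t n *\<^sub>R (x - a)"] t(3) r by simp
qed

lemma mpoly_eq_0_if_eval_eq_0: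
  fixes q :: "'n::finite mpoly"
  shows "(\<And>x. mpoly_eval q x = 0) \<Longrightarrow> q = 0"
  by (meson mpoly_real_nonroot)

text \<open>Lets evaluation at a point pass through determinants, and hence through minors.\<close>

interpretation mpoly_eval_hom: comm_ring_hom "\<lambda>q :: 'v mpoly. mpoly_eval q x"
  by unfold_locales (auto simp: mpoly_eval_add mpoly_eval_mult)

section \<open>Minors under evaluation, and the kernel of a matrix with a nonzero maximal
  minor\<close>

lemma submatrix_map_mat: "submatrix (map_mat f A) I J = map_mat f (submatrix A I J)"
  by (rule eq_matI) (auto simp: submatrix_index dim_submatrix pick_le)

lemma det_submatrix_mpoly_eval:
  "Determinant.det (submatrix (map_mat (\<lambda>q. mpoly_eval q x) A) I J) =
     mpoly_eval (Determinant.det (submatrix A I J)) x"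
  by (simp add: submatrix_map_mat)

lemma module_ring_mult: "Modules.module ((*) :: 'a::comm_ring_1 \<Rightarrow> 'a \<Rightarrow> 'a)"
  by unfold_locales (auto simp: algebra_simps)

lemma minor_ideal_eq_0_iff: "minor_ideal r P = {0} \<longleftrightarrow> minors r P \<subseteq> {0}"
proof -
  interpret R: Modules.module "(*) :: 'a \<Rightarrow> 'a \<Rightarrow> 'a"
    by (rule module_ring_mult)
  show ?thesis
  proof
    assume "minor_ideal r P = {0}"
    then show "minors r P \<subseteq> {0}"
      using R.span_superset[of "minors r P"] unfolding minor_ideal_def by simp
  next
    assume "minors r P \<subseteq> {0}"
    then have "R.span (minors r P) \<subseteq> {0}"
      by (rule R.span_minimal) (rule R.subspace_single_0)
    then show "minor_ideal r P = {0}"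
      using R.span_zero[of "minors r P"] unfolding minor_ideal_def by blast
  qed
qed

lemma pick_lessThan: "j < k \<Longrightarrow> pick {..<k} j = j"
proof -
  assume j: "j < k"
  then have "{a \<in> {..<k}. a < j} = {..<j}"
    by auto
  then show ?thesis
    using pick_card_in_set[of j "{..<k}"] j by simp
qed

text \<open>A minor of size \<open>k\<close> must use all \<open>k\<close> columns, so a nonzero one
  selects \<open>k\<close> of the equations with an invertible coefficient matrix.\<close>

lemma kernel_trivial_if_minor_nonzero:
  fixes P :: "'a::field mat"
  assumes P: "P \<in> carrier_mat l k" and M: "M \<in> minors k P" "M \<noteq> 0"
    and v: "\<And>i. i < l \<Longrightarrow> (\<Sum>j<k. P $$ (i, j) * v j) = 0" and j: "j < k"
  shows "v j = 0"
proof -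
  obtain I J where IJ: "M = Determinant.det (submatrix P I J)" "I \<subseteq> {..<l}" "J \<subseteq> {..<k}"
    "card I = k" "card J = k"
    using M(1) P unfolding minors_def by auto
  have J: "J = {..<k}"
    using IJ(3,5) by (intro card_subset_eq) auto
  have "{i. i < l \<and> i \<in> I} = I" "{j. j < k \<and> j \<in> J} = J"
    using IJ(2,3) by auto
  then have card: "card {i. i < dim_row P \<and> i \<in> I} = k" "card {j. j < dim_col P \<and> j \<in> J} = k"
    using IJ P by auto
  let ?A = "submatrix P I J"
  have A: "?A \<in> carrier_mat k k"
    using card by (auto simp: dim_submatrix intro!: carrier_matI)
  have "?A *\<^sub>v Matrix.vec k v = 0\<^sub>v k"
  proof (rule eq_vecI)
    fix i assume "i < dim_vec (0\<^sub>v k :: 'a Matrix.vec)"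
    then have i: "i < k" by simp
    have "pick I i < l"
      using i card P by (intro pick_le) auto
    have "vec_index (?A *\<^sub>v Matrix.vec k v) i = (\<Sum>j<k. ?A $$ (i, j) * v j)"
      using A i by (simp add: scalar_prod_def lessThan_atLeast0)
    also have "\<dots> = (\<Sum>j<k. P $$ (pick I i, j) * v j)"
      using i card by (intro sum.cong) (auto simp: submatrix_index J pick_lessThan)
    also have "\<dots> = 0"
      using v \<open>pick I i < l\<close> by simp
    finally show "vec_index (?A *\<^sub>v Matrix.vec k v) i = vec_index (0\<^sub>v k) i"
      using i by simp
  qed (use A in auto)
  then have "Matrix.vec k v = 0\<^sub>v k"
    using det_0_iff_vec_prod_zero_field[OF A] M(2) IJ(1) vec_carrier[of k v] by blast
  then show ?thesis
    using j by (metis index_vec index_zero_vec(1))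
qed

section \<open>Openness of the set of matrices with a nonzero minor\<close>

lemma mpoly_vars_add: "mpoly_vars (p + q) \<subseteq> mpoly_vars p \<union> mpoly_vars q"
  unfolding mpoly_vars_def using Poly_Mapping.keys_add[of p q] by blast

lemma mpoly_vars_uminus: "mpoly_vars (- p) = mpoly_vars p"
  by (simp add: mpoly_vars_def Poly_Mapping.keys.rep_eq)

lemma mpoly_vars_0 [simp]: "mpoly_vars 0 = {}"
  by (simp add: mpoly_vars_def)

lemma mpoly_vars_1 [simp]: "mpoly_vars 1 = {}"
  by (simp add: mpoly_vars_def)

lemma mpoly_vars_sum_subset:
  "(\<And>i. i \<in> A \<Longrightarrow> mpoly_vars (f i) \<subseteq> V) \<Longrightarrow> mpoly_vars (sum f A) \<subseteq> V"
proof (induction A rule: infinite_finite_induct)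
  case (insert i A)
  then show ?case using mpoly_vars_add[of "f i" "sum f A"] by auto
qed auto

lemma mpoly_vars_prod_subset:
  "(\<And>i. i \<in> A \<Longrightarrow> mpoly_vars (f i) \<subseteq> V) \<Longrightarrow> mpoly_vars (prod f A) \<subseteq> V"
proof (induction A rule: infinite_finite_induct)
  case (insert i A)
  then show ?case using mpoly_vars_mult[of "f i" "prod f A"] by auto
qed auto

lemma mpoly_vars_det_subset:
  assumes "\<And>i j. i < dim_row A \<Longrightarrow> j < dim_col A \<Longrightarrow> mpoly_vars (A $$ (i, j)) \<subseteq> V"
  shows "mpoly_vars (Determinant.det A) \<subseteq> V"
proof (cases "dim_row A = dim_col A")
  case True
  have "mpoly_vars (signof p * (\<Prod>i = 0..<dim_row A. A $$ (i, p i))) \<subseteq> V"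
    if "p permutes {0..<dim_row A}" for p
  proof -
    have "mpoly_vars (\<Prod>i = 0..<dim_row A. A $$ (i, p i)) \<subseteq> V"
      using assms True permutes_in_image[OF that]
      by (intro mpoly_vars_prod_subset) (metis atLeastLessThan_iff zero_le)
    then show ?thesis
      by (auto simp: sign_def mpoly_vars_uminus)
  qed
  then show ?thesis
    unfolding Determinant.det_def using True by (auto intro!: mpoly_vars_sum_subset)
qed (simp add: Determinant.det_def)

text \<open>For fixed \<open>a\<close>, the value at \<open>a\<close> of the entries of a matrix of degree at most \<open>d\<close>, as
  linear forms in the coefficients of that matrix.\<close>

definition eval_forms :: "nat \<Rightarrow> nat \<Rightarrow> nat \<Rightarrow> ('n::finite \<Rightarrow> complex) \<Rightarrow>
    (nat \<times> nat \<times> ('n \<Rightarrow>\<^sub>0 nat)) mpoly mat" where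
  "eval_forms l k d a = Matrix.mat l k (\<lambda>(i, j). \<Sum>\<alpha> | mi_degree \<alpha> \<le> d.
     Poly_Mapping.single (Poly_Mapping.single (i, j, \<alpha>) 1) (monom_eval \<alpha> a))"

lemma mpoly_vars_eval_forms:
  assumes "i < l" "j < k"
  shows "mpoly_vars (eval_forms l k d a $$ (i, j)) \<subseteq> coeff_index l k d"
proof -
  have "mpoly_vars (\<Sum>\<alpha> | mi_degree \<alpha> \<le> d.
      Poly_Mapping.single (Poly_Mapping.single (i, j, \<alpha>) (1::nat)) (monom_eval \<alpha> a)) \<subseteq> coeff_index l k d"
    using assms
    by (intro mpoly_vars_sum_subset) (simp add: mpoly_vars_def coeff_index_def)
  then show ?thesis
    using assms by (simp add: eval_forms_def)
qed

lemma eval_forms_mat_coeffs: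
  assumes P: "P \<in> matrices_upto l k d"
  shows "map_mat (\<lambda>q. mpoly_eval q (mat_coeffs l k d P)) (eval_forms l k d a) =
    map_mat (\<lambda>q. mpoly_eval q a) P"
proof (rule eq_matI)
  fix i j assume "i < dim_row (map_mat (\<lambda>q. mpoly_eval q a) P)" "j < dim_col (map_mat (\<lambda>q. mpoly_eval q a) P)"
  then have ij: "i < l" "j < k"
    using P by (auto simp: matrices_upto_def)
  have "mpoly_eval (eval_forms l k d a $$ (i, j)) (mat_coeffs l k d P) =
      (\<Sum>\<alpha> | mi_degree \<alpha> \<le> d. Poly_Mapping.lookup (P $$ (i, j)) \<alpha> * monom_eval \<alpha> a)"
    using ij unfolding eval_forms_def mat_coeffs_def
    by (auto simp: mpoly_eval_sum mpoly_eval_single monom_eval_def coeff_index_def intro!: sum.cong)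
  \<comment> \<open>The degree bound on \<open>P\<close> puts every key of the entry among the
    exponents summed over; the remaining ones have coefficient 0.\<close>
  also have "\<dots> = mpoly_eval (P $$ (i, j)) a"
    by (rule mpoly_eval_superset[symmetric])
       (use P ij in \<open>auto simp: matrices_upto_def finite_mi_degree_le\<close>)
  finally show "map_mat (\<lambda>q. mpoly_eval q (mat_coeffs l k d P)) (eval_forms l k d a) $$ (i, j) =
      map_mat (\<lambda>q. mpoly_eval q a) P $$ (i, j)"
    using P ij by (auto simp: matrices_upto_def eval_forms_def)
qed (use P in \<open>auto simp: matrices_upto_def eval_forms_def\<close>)

lemma openin_minor_ideal_nonzero:
  "openin (zariski_matrices l k) {P \<in> carrier_mat l k. minor_ideal r P \<noteq> {0 :: 'n::finite diffop}}"
  unfolding openin_zariski_matrices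
proof (intro conjI allI)
  fix d
  let ?U = "{P \<in> carrier_mat l k. minor_ideal r P \<noteq> {0 :: 'n diffop}}"
  let ?C = "coeff_index l k d :: (nat \<times> nat \<times> ('n \<Rightarrow>\<^sub>0 nat)) set"
  \<comment> \<open>One equation for every point \<open>a\<close> and every choice of rows and
    columns. A Zariski closed set may be cut out by any family of polynomials, so the coefficients
    of the minors need not be extracted.\<close>
  define S where "S = {Determinant.det (submatrix (eval_forms l k d a) I J) | (a :: 'n \<Rightarrow> complex) I J.
    I \<subseteq> {..<l} \<and> J \<subseteq> {..<k} \<and> card I = r \<and> card J = r}"
  have vars: "\<forall>q\<in>S. mpoly_vars q \<subseteq> ?C"
  proof
    fix q assume "q \<in> S"
    then obtain a :: "'n \<Rightarrow> complex" and I J where q: "q = Determinant.det (submatrix (eval_forms l k d a) I J)"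
      unfolding S_def by auto
    show "mpoly_vars q \<subseteq> ?C"
      unfolding q
    proof (rule mpoly_vars_det_subset)
      fix i j assume "i < dim_row (submatrix (eval_forms l k d a) I J)" "j < dim_col (submatrix (eval_forms l k d a) I J)"
      then have ij: "i < card {i. i < l \<and> i \<in> I}" "j < card {j. j < k \<and> j \<in> J}"
        by (simp_all add: dim_submatrix eval_forms_def)
      then have "submatrix (eval_forms l k d a) I J $$ (i, j) = eval_forms l k d a $$ (pick I i, pick J j)"
        by (intro submatrix_index) (simp_all add: eval_forms_def)
      then show "mpoly_vars (submatrix (eval_forms l k d a) I J $$ (i, j)) \<subseteq> ?C"
        using ij mpoly_vars_eval_forms pick_le by metis
    qed
  qed
  have mem: "mat_coeffs l k d P \<in> zero_locus ?C S \<longleftrightarrow> minor_ideal r P = {0}"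
    if P: "P \<in> matrices_upto l k d" for P :: "'n diffop mat"
  proof -
    have PC: "P \<in> carrier_mat l k"
      using P by (simp add: matrices_upto_def)
    have "mpoly_eval (Determinant.det (submatrix (eval_forms l k d a) I J)) (mat_coeffs l k d P) =
        mpoly_eval (Determinant.det (submatrix P I J)) a" for a I J
      unfolding det_submatrix_mpoly_eval[symmetric] eval_forms_mat_coeffs[OF P] ..
    then have "(\<forall>q\<in>S. mpoly_eval q (mat_coeffs l k d P) = 0) \<longleftrightarrow>
        (\<forall>I J. I \<subseteq> {..<l} \<and> J \<subseteq> {..<k} \<and> card I = r \<and> card J = r \<longrightarrow>
          (\<forall>a. mpoly_eval (Determinant.det (submatrix P I J)) a = 0))"
      unfolding S_def by auto metis
    also have "\<dots> \<longleftrightarrow> (\<forall>I J. I \<subseteq> {..<l} \<and> J \<subseteq> {..<k} \<and> card I = r \<and> card J = r \<longrightarrow>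
          Determinant.det (submatrix P I J) = 0)"
      using mpoly_eq_0_if_eval_eq_0 mpoly_eval_0 by metis
    also have "\<dots> \<longleftrightarrow> minors r P \<subseteq> {0}"
      using PC unfolding minors_def by auto
    finally show ?thesis
      unfolding minor_ideal_eq_0_iff zero_locus_def by (auto simp: mat_coeffs_def)
  qed
  have "zariski_closed ?C (zero_locus ?C S)"
    using vars unfolding zariski_closed_def by blast
  moreover have "(?C \<rightarrow>\<^sub>E UNIV) - ((?C \<rightarrow>\<^sub>E UNIV) - zero_locus ?C S) = zero_locus ?C S"
    unfolding zero_locus_def by blast
  ultimately have "openin (affine_zariski ?C) ((?C \<rightarrow>\<^sub>E UNIV) - zero_locus ?C S)"
    by (simp add: openin_affine_zariski)
  moreover have "?U \<inter> matrices_upto l k d =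
      mat_coeffs l k d -` ((?C \<rightarrow>\<^sub>E UNIV) - zero_locus ?C S) \<inter> matrices_upto l k d"
    using mem by (auto simp: matrices_upto_def mat_coeffs_def)
  ultimately show "openin (zariski_upto l k d) (?U \<inter> matrices_upto l k d)"
    unfolding zariski_upto_def openin_pullback_topology by blast
qed auto

text \<open>The identity matrix extended by zero rows has a minor equal to 1.\<close>

lemma ex_minor_ideal_nonzero:
  assumes "k \<le> l"
  obtains P :: "'a::comm_ring_1 mat" where "P \<in> carrier_mat l k" "minor_ideal k P \<noteq> {0}"
proof -
  define P :: "'a mat" where "P = Matrix.mat l k (\<lambda>(i, j). if i = j then 1 else 0)"
  have card: "card {i. i < dim_row P \<and> i \<in> {..<k}} = k" "card {j. j < dim_col P \<and> j \<in> {..<k}} = k"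
  proof -
    have "{i. i < dim_row P \<and> i \<in> {..<k}} = {..<k}" "{j. j < dim_col P \<and> j \<in> {..<k}} = {..<k}"
      using assms by (auto simp: P_def)
    then show "card {i. i < dim_row P \<and> i \<in> {..<k}} = k" "card {j. j < dim_col P \<and> j \<in> {..<k}} = k"
      by auto
  qed
  have "submatrix P {..<k} {..<k} = 1\<^sub>m k"
    by (rule eq_matI)
       (use assms card in \<open>simp_all add: submatrix_index dim_submatrix pick_lessThan P_def\<close>)
  then have "Determinant.det (submatrix P {..<k} {..<k}) = 1"
    by simp
  moreover have "Determinant.det (submatrix P {..<k} {..<k}) \<in> minors k P"
    unfolding minors_def using assms by (fastforce simp: P_def)
  ultimately have "\<not> minors k P \<subseteq> {0}"
    by (metis singletonD subsetD zero_neq_one)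
  then show ?thesis
    using that[of P] by (simp add: minor_ideal_eq_0_iff P_def)
qed

section \<open>The Laplace transform of compactly supported continuous functions\<close>

text \<open>The common class for both signal spaces: test functions belong to it, and so do the
  regularizations of a compactly supported distribution. Vanishing outside a ball is easier to check
  than compactness of a closure.\<close>

definition Cc :: "('a::euclidean_space \<Rightarrow> complex) set" where
  "Cc = {g. continuous_on UNIV g \<and> (\<exists>R. \<forall>x. R < norm x \<longrightarrow> g x = 0)}"

text \<open>The plus sign in the exponent is the reason why a derivative becomes multiplication by a
  component of \<open>- a\<close>, and \<open>P\<close> becomes P(-a).\<close>

definition laplace :: "('a::euclidean_space \<Rightarrow> complex) \<Rightarrow> 'a \<Rightarrow> complex" where
  "laplace g a = (\<integral>x. g x * exp (of_real (inner a x)) \<partial>lborel)"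

lemma Cc_D:
  assumes "g \<in> Cc"
  obtains R where "R > 0" "\<And>x. R < norm x \<Longrightarrow> g x = 0"
proof -
  obtain R where "\<forall>x. R < norm x \<longrightarrow> g x = 0"
    using assms unfolding Cc_def by blast
  then show ?thesis
    using that[of "max R 1"] by simp
qed

lemma integrable_Cc:
  assumes "g \<in> Cc"
  shows "integrable lborel g"
proof -
  obtain R where R: "\<And>x. R < norm x \<Longrightarrow> g x = 0"
    using assms by (rule Cc_D) blast
  have "integrable lborel (\<lambda>x. indicator (cball 0 R) x *\<^sub>R g x)"
    by (rule borel_integrable_compact)
       (use assms in \<open>auto simp: Cc_def intro: continuous_on_subset\<close>)
  also have "(\<lambda>x. indicator (cball 0 R) x *\<^sub>R g x) = g"
    using R by (auto simp: fun_eq_iff indicator_def)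
  finally show ?thesis .
qed

lemma Cc_mult:
  assumes "g \<in> Cc" "continuous_on UNIV h"
  shows "(\<lambda>x. g x * h x) \<in> Cc"
  using assms unfolding Cc_def by (auto intro!: continuous_on_mult)

lemma Cc_add:
  assumes "g \<in> Cc" "h \<in> Cc"
  shows "(\<lambda>x. g x + h x) \<in> Cc"
proof -
  obtain R where R: "\<And>x. R < norm x \<Longrightarrow> g x = 0"
    using assms(1) by (rule Cc_D) blast
  obtain S where S: "\<And>x. S < norm x \<Longrightarrow> h x = 0"
    using assms(2) by (rule Cc_D) blast
  have "\<forall>x. max R S < norm x \<longrightarrow> g x + h x = 0"
    using R S by simp
  then show ?thesis
    using assms unfolding Cc_def by (blast intro: continuous_on_add)
qed

lemma Cc_cmult: "g \<in> Cc \<Longrightarrow> (\<lambda>x. c * g x) \<in> Cc"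
  using Cc_mult[of g "\<lambda>_. c"] by (simp add: mult.commute)

lemma continuous_exp_inner:
  "continuous_on A (\<lambda>x. exp (of_real (inner a x)) :: complex)"
  by (intro continuous_intros)

lemma integrable_laplace:
  "g \<in> Cc \<Longrightarrow> integrable lborel (\<lambda>x. g x * exp (of_real (inner a x)))"
  by (intro integrable_Cc Cc_mult continuous_exp_inner)

lemma laplace_add:
  assumes "g \<in> Cc" "h \<in> Cc"
  shows "laplace (\<lambda>x. g x + h x) a = laplace g a + laplace h a"
  unfolding laplace_def using assms
  by (simp add: distrib_right integrable_laplace)

lemma laplace_cmult: "laplace (\<lambda>x. c * g x) a = c * laplace g a"
  by (simp add: laplace_def mult.assoc)

lemma laplace_zero [simp]: "laplace (\<lambda>x. 0) a = 0"
  by (simp add: laplace_def)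

lemma zero_in_Cc [simp]: "(\<lambda>x. 0) \<in> Cc"
  by (simp add: Cc_def)

lemma laplace_sum:
  assumes "\<And>i. i \<in> I \<Longrightarrow> g i \<in> Cc"
  shows "(\<lambda>x. \<Sum>i\<in>I. g i x) \<in> Cc" "laplace (\<lambda>x. \<Sum>i\<in>I. g i x) a = (\<Sum>i\<in>I. laplace (g i) a)"
proof -
  have "(\<lambda>x. \<Sum>i\<in>I. g i x) \<in> Cc \<and> laplace (\<lambda>x. \<Sum>i\<in>I. g i x) a = (\<Sum>i\<in>I. laplace (g i) a)"
    using assms
    by (induction I rule: infinite_finite_induct) (simp_all add: Cc_add laplace_add)
  then show "(\<lambda>x. \<Sum>i\<in>I. g i x) \<in> Cc"
    "laplace (\<lambda>x. \<Sum>i\<in>I. g i x) a = (\<Sum>i\<in>I. laplace (g i) a)"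
    by auto
qed

lemma uniformly_continuous_Cc:
  assumes "g \<in> Cc"
  shows "uniformly_continuous_on UNIV g"
proof -
  obtain R where R: "\<And>x. R < norm x \<Longrightarrow> g x = 0"
    using assms by (rule Cc_D) blast
  \<comment> \<open>The margin 1 handles the boundary: two points at distance less than 1 either
    both lie in this ball or both have norm greater than \<open>R\<close>, where \<open>g\<close> is
    0.\<close>
  have "uniformly_continuous_on (cball 0 (R + 1)) g"
    by (rule compact_uniformly_continuous)
       (use assms in \<open>auto simp: Cc_def intro: continuous_on_subset\<close>)
  note uc = this[unfolded uniformly_continuous_on_def]
  show ?thesis
    unfolding uniformly_continuous_on_def
  proof (intro allI impI)
    fix e :: real assume e: "e > 0"
    then obtain d where d: "d > 0"
      "\<And>x y. \<lbrakk>norm x \<le> R + 1; norm y \<le> R + 1; dist y x < d\<rbrakk> \<Longrightarrow> dist (g y) (g x) < e"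
      using uc by (metis mem_cball_0)
    have "dist (g y) (g x) < e" if "dist y x < min d 1" for x y
    proof (cases "norm x \<le> R + 1 \<and> norm y \<le> R + 1")
      case True
      then show ?thesis using d that by simp
    next
      case False
      have "\<bar>norm y - norm x\<bar> < 1"
        using that norm_triangle_ineq3[of y x] by (simp add: dist_norm)
      then have "R < norm x" "R < norm y"
        using False by linarith+
      then show ?thesis using R e by simp
    qed
    then show "\<exists>d>0. \<forall>x\<in>UNIV. \<forall>x'\<in>UNIV. dist x' x < d \<longrightarrow> dist (g x') (g x) < e"
      using d(1) by (intro exI[of _ "min d 1"]) auto
  qed
qed

text \<open>By the mean value inequality on the segment from \<open>x\<close>, the error is at most
  the variation of \<open>h\<close> along it, and uniform continuity bounds this variation
  independently of \<open>x\<close>.\<close>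

lemma uniform_limit_difference_quotient:
  fixes g h :: "'a::euclidean_space \<Rightarrow> complex"
  assumes D: "\<And>x. ((\<lambda>t. g (x + t *\<^sub>R e)) has_vector_derivative h x) (at 0)"
    and "uniformly_continuous_on UNIV h"
  shows "uniform_limit UNIV (\<lambda>t x. (g (x + t *\<^sub>R e) - g x) /\<^sub>R t) h (at 0)"
  unfolding uniform_limit_iff
proof (intro allI impI)
  fix \<epsilon> :: real assume \<epsilon>: "\<epsilon> > 0"
  then obtain d where d: "d > 0" "\<And>x y. dist y x < d \<Longrightarrow> dist (h y) (h x) < \<epsilon> / 2"
    using assms(2) unfolding uniformly_continuous_on_def by (metis UNIV_I half_gt_zero)
  \<comment> \<open>For \<open>\<bar>t\<bar> < r\<close> the displacement along \<open>e\<close> is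
    shorter than \<open>d\<close>; the added 1 allows \<open>e = 0\<close>.\<close>
  define r where "r = d / (norm e + 1)"
  have r: "r > 0"
    using d(1) by (simp add: r_def add_nonneg_pos)
  have *: "dist ((g (x + t *\<^sub>R e) - g x) /\<^sub>R t) (h x) < \<epsilon>" if t: "t \<noteq> 0" "\<bar>t\<bar> < r" for t x
  proof -
    \<comment> \<open>The hypothesis \<open>D\<close> concerns parameter 0 only, but at every base
      point. Moving the base point to \<open>x + s *\<^sub>R e\<close> turns it into the derivative
      at \<open>s\<close>.\<close>
    have der: "((\<lambda>t. g (x + t *\<^sub>R e)) has_vector_derivative h (x + s *\<^sub>R e)) (at s)" for s
    proof -
      have 1: "((\<lambda>t. t - s) has_vector_derivative 1) (at s)"
        by (auto intro!: derivative_eq_intros)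
      have 2: "((\<lambda>t. g ((x + s *\<^sub>R e) + t *\<^sub>R e)) has_vector_derivative h (x + s *\<^sub>R e)) (at (s - s))"
        using D[of "x + s *\<^sub>R e"] by simp
      show ?thesis
        using vector_diff_chain_at[OF 1 2] by (simp add: o_def algebra_simps)
    qed
    have "norm (g (x + t *\<^sub>R e) - g (x + 0 *\<^sub>R e) - (t - 0) *\<^sub>R h (x + 0 *\<^sub>R e)) \<le> norm (t - 0) * (\<epsilon> / 2)"
    proof (rule vector_differentiable_bound_linearization[where S = "closed_segment 0 t"])
      fix s assume s: "s \<in> closed_segment 0 t"
      show "((\<lambda>t. g (x + t *\<^sub>R e)) has_vector_derivative h (x + s *\<^sub>R e)) (at s within closed_segment 0 t)"
        by (rule has_vector_derivative_at_within[OF der])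
      have "\<bar>s\<bar> \<le> \<bar>t\<bar>"
        using s by (auto simp: closed_segment_eq_real_ivl split: if_splits)
      then have "norm (s *\<^sub>R e) \<le> \<bar>t\<bar> * norm e"
        by (simp add: mult_right_mono)
      also have "\<dots> \<le> \<bar>t\<bar> * (norm e + 1)"
        by (simp add: mult_left_mono)
      also have "\<dots> < d"
        using t(2) by (simp add: r_def pos_less_divide_eq add_nonneg_pos)
      finally show "norm (h (x + s *\<^sub>R e) - h (x + 0 *\<^sub>R e)) \<le> \<epsilon> / 2"
        using d(2)[of "x + s *\<^sub>R e" x] by (simp add: dist_norm less_imp_le)
    qed auto
    then have "norm (g (x + t *\<^sub>R e) - g x - t *\<^sub>R h x) \<le> \<bar>t\<bar> * (\<epsilon> / 2)"
      by simp
    moreover have "g (x + t *\<^sub>R e) - g x - t *\<^sub>R h x = t *\<^sub>R ((g (x + t *\<^sub>R e) - g x) /\<^sub>R t - h x)"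
      using t(1) by (simp add: scaleR_diff_right)
    ultimately have "norm ((g (x + t *\<^sub>R e) - g x) /\<^sub>R t - h x) \<le> \<epsilon> / 2"
      using t(1) by simp
    then show ?thesis using \<epsilon> by (simp add: dist_norm)
  qed
  show "\<forall>\<^sub>F t in at 0. \<forall>x\<in>UNIV. dist ((g (x + t *\<^sub>R e) - g x) /\<^sub>R t) (h x) < \<epsilon>"
    unfolding eventually_at using r * by (intro exI[of _ r]) (auto simp: dist_norm)
qed

lemma lborel_integral_translate:
  fixes f :: "'a::euclidean_space \<Rightarrow> complex"
  assumes "f \<in> borel_measurable borel"
  shows "(\<integral>x. f (x + c) \<partial>lborel) = (\<integral>x. f x \<partial>lborel)"
proof -
  have "(\<integral>x. f x \<partial>lborel) = (\<integral>x. f x \<partial>distr lborel borel ((+) c))"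
    by (simp add: lborel_distr_plus)
  also have "\<dots> = (\<integral>x. f (c + x) \<partial>lborel)"
    by (rule integral_distr) (use assms in auto)
  finally show ?thesis by (simp add: add.commute)
qed

lemma Cc_translate:
  assumes "g \<in> Cc"
  shows "(\<lambda>x. g (x + c)) \<in> Cc"
proof -
  obtain R where R: "\<And>x. R < norm x \<Longrightarrow> g x = 0"
    using assms by (rule Cc_D) blast
  have "g (x + c) = 0" if "R + norm c < norm x" for x
    using R[of "x + c"] that norm_triangle_ineq4[of "x + c" c] by simp
  moreover have "continuous_on UNIV (\<lambda>x. g (x + c))"
    by (rule continuous_on_compose2[of UNIV g])
       (use assms in \<open>auto simp: Cc_def intro!: continuous_intros\<close>)
  ultimately show ?thesis unfolding Cc_def by blast
qed

text \<open>Lets \<open>\<epsilon>\<close> tend to 0 in estimates whose factor \<open>c\<close> is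
  the volume of a ball or an L1 norm.\<close>

lemma nonpos_if_le_multiples:
  fixes c x :: real
  assumes "c \<ge> 0" "\<And>\<epsilon>. \<epsilon> > 0 \<Longrightarrow> x \<le> \<epsilon> * c"
  shows "x \<le> 0"
proof (cases "c = 0")
  case True
  then show ?thesis using assms(2)[of 1] by simp
next
  case False
  show ?thesis
  proof (rule field_le_epsilon)
    fix e :: real assume "e > 0"
    then show "x \<le> 0 + e"
      using assms(1) assms(2)[of "e / c"] False by simp
  qed
qed

text \<open>Translation invariance gives every difference quotient of \<open>g\<close> the integral
  0. The quotients converge uniformly to \<open>h\<close> and vanish, like \<open>h\<close>, outside
  a common ball, so the integrals converge as well.\<close>

lemma integral_directional_derivative:
  assumes g: "g \<in> Cc" and h: "h \<in> Cc"
    and D: "\<And>x. ((\<lambda>t. g (x + t *\<^sub>R e)) has_vector_derivative h x) (at 0)"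
  shows "(\<integral>x. h x \<partial>lborel) = 0"
proof -
  obtain R where R: "R > 0" "\<And>x. R < norm x \<Longrightarrow> g x = 0"
    using g by (rule Cc_D) blast
  obtain S where S: "S > 0" "\<And>x. S < norm x \<Longrightarrow> h x = 0"
    using h by (rule Cc_D) blast
  \<comment> \<open>Outside this ball \<open>h\<close> and \<open>g\<close> are 0 at
    \<open>x\<close>, and \<open>g\<close> is 0 at every \<open>x + t *\<^sub>R e\<close> with
    \<open>\<bar>t\<bar> \<le> 1\<close>; this is why \<open>t\<close> is capped at 1 below.\<close>
  define B where "B = cball (0::'a) (R + S + norm e)"
  have B: "B \<in> sets lborel" "emeasure lborel B < \<infinity>"
    using emeasure_lborel_cball_finite[of "0::'a" "R + S + norm e"] unfolding B_def by simp_all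
  have le: "norm (\<integral>x. h x \<partial>lborel) \<le> \<epsilon> * measure lborel B" if \<epsilon>: "\<epsilon> > 0" for \<epsilon>
  proof -
    have "uniform_limit UNIV (\<lambda>t x. (g (x + t *\<^sub>R e) - g x) /\<^sub>R t) h (at 0)"
      using D uniformly_continuous_Cc[OF h] by (rule uniform_limit_difference_quotient)
    then have "\<forall>\<^sub>F t in at 0. \<forall>x\<in>UNIV. dist ((g (x + t *\<^sub>R e) - g x) /\<^sub>R t) (h x) < \<epsilon>"
      using \<epsilon> unfolding uniform_limit_iff by blast
    then obtain d where d: "d > 0"
      "\<And>t x. \<lbrakk>t \<noteq> 0; \<bar>t\<bar> < d\<rbrakk> \<Longrightarrow> dist ((g (x + t *\<^sub>R e) - g x) /\<^sub>R t) (h x) < \<epsilon>"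
      unfolding eventually_at by (auto simp: dist_norm)
    define t where "t = min (d / 2) 1"
    have t: "t \<noteq> 0" "\<bar>t\<bar> < d" "\<bar>t\<bar> \<le> 1"
      using d(1) by (auto simp: t_def)
    let ?q = "\<lambda>x. (g (x + t *\<^sub>R e) - g x) /\<^sub>R t"
    have int: "integrable lborel (\<lambda>x. g (x + t *\<^sub>R e))" "integrable lborel g" "integrable lborel h"
      using g h by (auto intro: integrable_Cc Cc_translate)
    then have q: "integrable lborel ?q"
      by simp
    have "(\<integral>x. ?q x \<partial>lborel) = 0"
      using int lborel_integral_translate[of g "t *\<^sub>R e"] by simp
    then have "(\<integral>x. h x \<partial>lborel) = (\<integral>x. h x - ?q x \<partial>lborel)"
      using int(3) q by (subst Bochner_Integration.integral_diff) auto
    also have "norm \<dots> \<le> (\<integral>x. norm (h x - ?q x) \<partial>lborel)"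
      by (rule integral_norm_bound)
    also have "\<dots> \<le> (\<integral>x. indicator B x *\<^sub>R \<epsilon> \<partial>lborel)"
    proof (rule integral_mono)
      show "norm (h x - ?q x) \<le> indicator B x *\<^sub>R \<epsilon>" for x
      proof (cases "x \<in> B")
        case True
        then show ?thesis
          using d(2)[OF t(1,2), of x] by (simp add: dist_norm norm_minus_commute)
      next
        case False
        then have nx: "norm x > R + S + norm e"
          by (simp add: B_def)
        have "norm (t *\<^sub>R e) \<le> 1 * norm e"
          unfolding norm_scaleR by (rule mult_right_mono) (use t in auto)
        then have "norm (x + t *\<^sub>R e) > R"
          using norm_triangle_ineq4[of "x + t *\<^sub>R e" "t *\<^sub>R e"] S(1) nx by simp
        moreover have "norm x > R" "norm x > S"
          using nx R(1) S(1) norm_ge_zero[of e] by linarith+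
        ultimately show ?thesis
          using R(2) S(2) False by simp
      qed
    next
      show "integrable lborel (\<lambda>x. norm (h x - ?q x))"
        using int(3) q by (intro integrable_norm Bochner_Integration.integrable_diff)
      show "integrable lborel (\<lambda>x. indicator B x *\<^sub>R \<epsilon>)"
        using B by (intro integrable_scaleR_left integrable_real_indicator) auto
    qed
    also have "\<dots> = \<epsilon> * measure lborel B"
      using B by simp
    finally show ?thesis .
  qed
  have "norm (\<integral>x. h x \<partial>lborel) \<le> 0"
    by (rule nonpos_if_le_multiples[OF measure_nonneg le])
  then show ?thesis by simp
qed

text \<open>Integration by parts in disguise: \<open>?H\<close> is the directional derivative of
  \<open>g\<close> times the exponential, so its integral is 0.\<close>

lemma laplace_directional_derivative:
  assumes g: "g \<in> Cc" and h: "h \<in> Cc"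
    and D: "\<And>x. ((\<lambda>t. g (x + t *\<^sub>R e)) has_vector_derivative h x) (at 0)"
  shows "laplace h a = - of_real (inner a e) * laplace g a"
proof -
  let ?E = "\<lambda>x. exp (of_real (inner a x)) :: complex"
  let ?H = "\<lambda>x. h x * ?E x + of_real (inner a e) * (g x * ?E x)"
  have "(\<integral>x. ?H x \<partial>lborel) = 0"
  proof (rule integral_directional_derivative[where e = e])
    show "(\<lambda>x. g x * ?E x) \<in> Cc"
      using g by (intro Cc_mult continuous_exp_inner)
    show "?H \<in> Cc"
      using g h by (intro Cc_mult Cc_add Cc_cmult continuous_exp_inner)
    fix x
    have E: "((\<lambda>t. ?E (x + t *\<^sub>R e)) has_vector_derivative of_real (inner a e) * ?E x) (at 0)"
    proof -
      have 1: "((\<lambda>t. inner a x + t * inner a e) has_vector_derivative inner a e) (at 0)"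
        unfolding has_real_derivative_iff_has_vector_derivative[symmetric]
        by (rule derivative_eq_intros refl | simp)+
      have 2: "((\<lambda>r. exp (of_real r) :: complex) has_vector_derivative exp (of_real (inner a x + 0 * inner a e))) (at (inner a x + 0 * inner a e))"
        by (rule has_vector_derivative_real_field) (rule DERIV_exp)
      show ?thesis
        using vector_diff_chain_at[OF 1 2] by (simp add: o_def inner_add_right scaleR_conv_of_real)
    qed
    show "((\<lambda>t. g (x + t *\<^sub>R e) * ?E (x + t *\<^sub>R e)) has_vector_derivative ?H x) (at 0)"
      using has_vector_derivative_mult[OF D[of x] E] by (simp add: mult_ac add.commute)
  qed
  then show ?thesis
    unfolding laplace_def
    using integrable_laplace[OF g] integrable_laplace[OF h]
    by (simp add: eq_neg_iff_add_eq_0)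
qed

section \<open>Injectivity and continuity of the transform\<close>

inductive_set exp_sums :: "('a::euclidean_space \<Rightarrow> real) set" where
  exp: "(\<lambda>x. c * exp (inner a x)) \<in> exp_sums"
| add: "f \<in> exp_sums \<Longrightarrow> g \<in> exp_sums \<Longrightarrow> (\<lambda>x. f x + g x) \<in> exp_sums"

text \<open>Products of exponentials are exponentials with added parameters. This makes the sums an
  algebra, as the Stone-Weierstrass theorem demands.\<close>

lemma exp_sums_mult:
  assumes "f \<in> exp_sums" "g \<in> exp_sums"
  shows "(\<lambda>x. f x * g x) \<in> exp_sums"
  using assms
proof (induction f arbitrary: g rule: exp_sums.induct)
  case (exp c a)
  from exp show ?case
  proof (induction g rule: exp_sums.induct)
    case (exp c' a')
    then show ?case
      using exp_sums.exp[of "c * c'" "a + a'"]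
      by (simp add: inner_add_left exp_add mult_ac)
  next
    case (add f g)
    then show ?case
      using exp_sums.add by (fastforce simp: distrib_left)
  qed
next
  case (add f1 f2)
  then show ?case
    using exp_sums.add[OF add.IH(1)[OF add.prems] add.IH(2)[OF add.prems]]
    by (simp add: distrib_right)
qed

lemma function_ring_exp_sums:
  fixes K :: "'a::euclidean_space set"
  assumes "compact K"
  shows "function_ring_on exp_sums K"
proof
  show "compact K" by fact
  show "continuous_on K f" if "f \<in> exp_sums" for f :: "'a \<Rightarrow> real"
    using that by induction (auto intro!: continuous_intros)
  show "(\<lambda>x. f x + g x) \<in> exp_sums" if "f \<in> exp_sums" "g \<in> exp_sums" for f g :: "'a \<Rightarrow> real"
    using that by (rule exp_sums.add)
  show "(\<lambda>x. f x * g x) \<in> exp_sums" if "f \<in> exp_sums" "g \<in> exp_sums" for f g :: "'a \<Rightarrow> real"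
    using that by (rule exp_sums_mult)
  show "(\<lambda>_. c) \<in> exp_sums" for c
    using exp_sums.exp[of c 0] by simp
  fix x y :: 'a assume "x \<noteq> y"
  \<comment> \<open>The exponential with parameter \<open>x - y\<close> separates the two points:
    its exponents there differ by the squared norm of \<open>x - y\<close>.\<close>
  then have "inner (x - y) (x - y) \<noteq> 0" by simp
  then have "exp (inner (x - y) x) \<noteq> exp (inner (x - y) y)"
    by (simp add: inner_diff_right)
  then show "\<exists>f\<in>exp_sums. f x \<noteq> f y"
    using exp_sums.exp[of 1 "x - y"] by (intro bexI) auto
qed

text \<open>\<open>g\<close> is orthogonal to all sums of exponentials, and these approximate
  \<open>g\<close> itself uniformly on a ball outside of which it is 0. Hence \<open>g\<close> is
  orthogonal to itself, so it is 0 almost everywhere, and by continuity everywhere.\<close>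

lemma real_eq_0_if_laplace_eq_0:
  fixes g :: "'a::euclidean_space \<Rightarrow> real"
  assumes cont: "continuous_on UNIV g" and R: "\<And>x. R < norm x \<Longrightarrow> g x = 0"
    and L: "\<And>a. (\<integral>x. g x * exp (inner a x) \<partial>lborel) = 0"
  shows "g x = 0"
proof -
  have int: "integrable lborel (\<lambda>x. g x * f x)" if "continuous_on UNIV f" for f
  proof -
    have "integrable lborel (\<lambda>x. indicator (cball 0 R) x *\<^sub>R (g x * f x))"
      by (rule borel_integrable_compact)
         (use cont that in \<open>auto intro!: continuous_on_mult intro: continuous_on_subset\<close>)
    also have "(\<lambda>x. indicator (cball 0 R) x *\<^sub>R (g x * f x)) = (\<lambda>x. g x * f x)"
      using R by (auto simp: fun_eq_iff indicator_def)
    finally show ?thesis .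
  qed
  have R0: "continuous_on UNIV f \<and> (\<integral>x. g x * f x \<partial>lborel) = 0" if "f \<in> exp_sums" for f
    using that
  proof induction
    case (exp c a)
    have "(\<integral>x. g x * (c * exp (inner a x)) \<partial>lborel) = (\<integral>x. c * (g x * exp (inner a x)) \<partial>lborel)"
      by (simp add: mult_ac)
    then show ?case using L[of a] by (auto intro!: continuous_intros)
  next
    case (add f h)
    then show ?case
      using int[of f] int[of h] by (auto simp: distrib_left intro!: continuous_intros)
  qed
  interpret function_ring_on exp_sums "cball (0::'a) R"
    by (rule function_ring_exp_sums) simp
  have int1: "integrable lborel g"
    using int[of "\<lambda>_. 1"] by (simp)
  have le: "(\<integral>x. g x * g x \<partial>lborel) \<le> \<epsilon> * (\<integral>x. \<bar>g x\<bar> \<partial>lborel)" if "\<epsilon> > 0" for \<epsilon>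
  proof -
    obtain f where f: "f \<in> exp_sums" "\<And>x. x \<in> cball 0 R \<Longrightarrow> \<bar>g x - f x\<bar> < \<epsilon>"
      using Stone_Weierstrass_basic[OF continuous_on_subset[OF cont] \<open>\<epsilon> > 0\<close>] by auto
    have ig: "integrable lborel (\<lambda>x. g x * g x)" "integrable lborel (\<lambda>x. g x * f x)"
      using int cont R0[OF f(1)] by auto
    have "(\<integral>x. g x * g x \<partial>lborel) = (\<integral>x. g x * g x - g x * f x \<partial>lborel)"
      using ig R0[OF f(1)] by simp
    also have "\<dots> \<le> (\<integral>x. \<epsilon> * \<bar>g x\<bar> \<partial>lborel)"
    proof (rule integral_mono)
      show "g x * g x - g x * f x \<le> \<epsilon> * \<bar>g x\<bar>" for x
      proof (cases "x \<in> cball 0 R")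
        case True
        have "g x * g x - g x * f x \<le> \<bar>g x * (g x - f x)\<bar>"
          by (simp add: algebra_simps)
        also have "\<dots> = \<bar>g x - f x\<bar> * \<bar>g x\<bar>"
          by (simp add: abs_mult mult.commute)
        also have "\<dots> \<le> \<epsilon> * \<bar>g x\<bar>"
          using f(2)[OF True] by (intro mult_right_mono) auto
        finally show ?thesis .
      next
        case False
        then show ?thesis using R[of x] by simp
      qed
    qed (use ig int1 in auto)
    finally show ?thesis by simp
  qed
  have "(\<integral>x. g x * g x \<partial>lborel) \<le> 0"
    by (rule nonpos_if_le_multiples[OF _ le]) simp
  moreover have "(\<integral>x. g x * g x \<partial>lborel) \<ge> 0"
    by simp
  ultimately have "(\<integral>x. g x * g x \<partial>lborel) = 0"
    by linarith
  then have "AE x in lborel. g x * g x = 0"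
    using integral_nonneg_eq_0_iff_AE[OF int[OF cont]] by simp
  then have "AE x in lebesgue. x \<in> {x. g x = 0}"
    using AE_completion by fastforce
  moreover have "closed {x. g x = 0}"
    by (rule closed_Collect_eq) (use cont in auto)
  ultimately show ?thesis
    using mem_closed_if_AE_lebesgue by blast
qed

text \<open>The kernel is real, so the transform splits into those of the real and the imaginary
  part.\<close>

lemma eq_0_if_laplace_eq_0:
  assumes g: "g \<in> Cc" and L: "\<And>a. laplace g a = 0"
  shows "g x = 0"
proof -
  obtain R where R: "\<And>x. R < norm x \<Longrightarrow> g x = 0"
    using g by (rule Cc_D) blast
  have cont: "continuous_on UNIV g"
    using g by (simp add: Cc_def)
  have eq: "g x * exp (of_real (inner a x)) = Complex (Re (g x) * exp (inner a x)) (Im (g x) * exp (inner a x))" for a x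
    by (simp add: exp_of_real complex_eq_iff)
  have re: "(\<integral>x. Re (g x) * exp (inner a x) \<partial>lborel) = 0" for a
    using L[of a] integral_Re[OF integrable_laplace[OF g], of a] unfolding laplace_def eq by simp
  have im: "(\<integral>x. Im (g x) * exp (inner a x) \<partial>lborel) = 0" for a
    using L[of a] integral_Im[OF integrable_laplace[OF g], of a] unfolding laplace_def eq by simp
  have "Re (g x) = 0"
    by (rule real_eq_0_if_laplace_eq_0[OF _ _ re, of R])
       (use R cont in \<open>auto intro!: continuous_intros\<close>)
  moreover have "Im (g x) = 0"
    by (rule real_eq_0_if_laplace_eq_0[OF _ _ im, of R])
       (use R cont in \<open>auto intro!: continuous_intros\<close>)
  ultimately show ?thesis by (simp add: complex_eq_iff)
qed

text \<open>Dominated convergence: where \<open>g\<close> is nonzero, \<open>inner (a n) x\<close>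
  is at most \<open>M * R\<close>, with \<open>M\<close> a bound for the convergent
  sequence.\<close>

lemma laplace_tendsto:
  assumes g: "g \<in> Cc" and a: "a \<longlonglongrightarrow> b"
  shows "(\<lambda>n. laplace g (a n)) \<longlonglongrightarrow> laplace g b"
proof -
  obtain R where R: "R > 0" "\<And>x. R < norm x \<Longrightarrow> g x = 0"
    using g by (rule Cc_D) blast
  obtain M where M: "\<And>n. norm (a n) \<le> M"
    using a by (meson Bseq_def convergentI convergent_imp_Bseq)
  show ?thesis
    unfolding laplace_def
  proof (rule integral_dominated_convergence)
    show "integrable lborel (\<lambda>x. norm (g x) * exp (M * R))"
      using integrable_Cc[OF g] by simp
    show "AE x in lborel. (\<lambda>n. g x * exp (of_real (inner (a n) x))) \<longlonglongrightarrow> g x * exp (of_real (inner b x))"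
      using a by (intro AE_I2 tendsto_intros)
    fix n
    show "AE x in lborel. norm (g x * exp (of_real (inner (a n) x))) \<le> norm (g x) * exp (M * R)"
    proof (rule AE_I2)
      fix x
      show "norm (g x * exp (of_real (inner (a n) x))) \<le> norm (g x) * exp (M * R)"
      proof (cases "norm x \<le> R")
        case True
        have "inner (a n) x \<le> norm (a n) * norm x"
          by (rule norm_cauchy_schwarz)
        also have "\<dots> \<le> M * R"
          using M[of n] True R(1) by (intro mult_mono) (auto intro: order_trans[OF norm_ge_zero])
        finally show ?thesis
          by (auto simp: norm_mult intro!: mult_left_mono)
      next
        case False
        then show ?thesis using R(2)[of x] by simp
      qed
    qed
  qed (use integrable_laplace[OF g] in \<open>auto intro: borel_measurable_integrable\<close>)
qed

section \<open>Test functions and distributions\<close>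

lemma smooth_foldr_partial: "smooth f \<Longrightarrow> smooth (foldr partial is f)"
  unfolding smooth_def by (metis foldr_append o_apply)

lemma smooth_differentiable: "smooth f \<Longrightarrow> f differentiable (at x)"
  unfolding smooth_def by (metis foldr.simps(1) id_apply)

lemma smooth_has_derivative:
  "smooth f \<Longrightarrow> (f has_derivative frechet_derivative f (at x)) (at x)"
  using smooth_differentiable frechet_derivative_works by blast

lemma partial_eqI: "(f has_derivative D) (at x) \<Longrightarrow> partial i f x = D (axis i 1)"
  unfolding partial_def by (simp add: frechet_derivative_at[symmetric])

lemma smooth_continuous_on: "smooth f \<Longrightarrow> continuous_on A f"
  by (intro continuous_at_imp_continuous_on ballI differentiable_imp_continuous_within
      smooth_differentiable)

lemma has_vector_derivative_partial:
  assumes "f differentiable (at x)"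
  shows "((\<lambda>t. f (x + t *\<^sub>R axis i 1)) has_vector_derivative partial i f x) (at 0)"
proof -
  let ?D = "frechet_derivative f (at x)"
  have D: "(f has_derivative ?D) (at (x + 0 *\<^sub>R axis i 1))"
    using assms by (simp add: frechet_derivative_works)
  have "((\<lambda>t::real. x + t *\<^sub>R axis i 1) has_derivative (\<lambda>t. t *\<^sub>R axis i 1)) (at 0)"
    by (auto intro!: derivative_eq_intros)
  from has_derivative_compose[OF this D]
  have "((\<lambda>t. f (x + t *\<^sub>R axis i 1)) has_derivative (\<lambda>t. ?D (t *\<^sub>R axis i 1))) (at 0)" .
  then show ?thesis
    using linear_frechet_derivative[OF assms]
    unfolding has_vector_derivative_def partial_def by (simp add: linear_scale)
qed

lemma foldr_partial_zero [simp]: "foldr partial is (\<lambda>x. 0) = (\<lambda>x. 0)"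
proof (induction "is")
  case (Cons i "is")
  have "partial i (\<lambda>x. 0) = (\<lambda>x. 0)"
    by (rule ext, subst partial_eqI[OF has_derivative_const]) simp
  with Cons show ?case by simp
qed simp

text \<open>The shape \<open>c * f x + g x\<close> treats scaling and addition in one induction.
  Differences below are written with the factor \<open>- 1\<close> to match it.\<close>

lemma foldr_partial_lincomb:
  assumes "smooth f" "smooth g"
  shows "foldr partial is (\<lambda>x. c * f x + g x) = (\<lambda>x. c * foldr partial is f x + foldr partial is g x)"
proof (induction "is")
  case (Cons i "is")
  let ?f = "foldr partial is f" and ?g = "foldr partial is g"
  have "partial i (\<lambda>x. c * ?f x + ?g x) x = c * partial i ?f x + partial i ?g x" for x
  proof -
    have "(?f has_derivative frechet_derivative ?f (at x)) (at x)"
      "(?g has_derivative frechet_derivative ?g (at x)) (at x)"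
      by (rule smooth_has_derivative, rule smooth_foldr_partial, rule assms)+
    then have "((\<lambda>x. c * ?f x + ?g x) has_derivative
        (\<lambda>h. c * frechet_derivative ?f (at x) h + frechet_derivative ?g (at x) h)) (at x)"
      by (auto intro!: derivative_eq_intros)
    from partial_eqI[OF this] show ?thesis
      by (simp add: partial_def)
  qed
  then show ?case by (intro ext) (simp add: Cons.IH)
qed simp

lemma smooth_lincomb:
  assumes "smooth f" "smooth g"
  shows "smooth (\<lambda>x. c * f x + g x)"
  unfolding smooth_def foldr_partial_lincomb[OF assms]
  using assms by (intro allI differentiable_add differentiable_mult differentiable_const
    smooth_differentiable smooth_foldr_partial)

lemma foldr_partial_translate:
  assumes "smooth f"
  shows "foldr partial is (\<lambda>y. f (y - h)) = (\<lambda>y. foldr partial is f (y - h))"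
proof (induction "is")
  case (Cons i "is")
  let ?f = "foldr partial is f"
  have "partial i (\<lambda>y. ?f (y - h)) y = partial i ?f (y - h)" for y
  proof -
    have 1: "(?f has_derivative frechet_derivative ?f (at (y - h))) (at (y - h))"
      using assms by (intro smooth_has_derivative smooth_foldr_partial)
    have 2: "((\<lambda>y. y - h) has_derivative (\<lambda>v. v)) (at y)"
      by (auto intro!: derivative_eq_intros)
    from partial_eqI[OF has_derivative_compose[OF 2 1]] show ?thesis
      by (simp add: partial_def)
  qed
  then show ?case by (intro ext) (simp add: Cons.IH)
qed simp

lemma smooth_translate:
  assumes "smooth f"
  shows "smooth (\<lambda>y. f (y - h))"
  unfolding smooth_def foldr_partial_translate[OF assms]
proof (intro allI)
  fix "is" x
  have 1: "foldr partial is f differentiable (at (x - h))"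
    using assms by (simp add: smooth_differentiable smooth_foldr_partial)
  show "(\<lambda>y. foldr partial is f (y - h)) differentiable (at x)"
    using differentiable_chain_at[of "\<lambda>y. y - h" x "foldr partial is f"] 1
    by (simp add: o_def)
qed

lemma supp_subset_iff: "closed K \<Longrightarrow> supp \<phi> \<subseteq> K \<longleftrightarrow> (\<forall>x. x \<notin> K \<longrightarrow> \<phi> x = 0)"
  proof -
  assume "closed K"
  then have "supp \<phi> \<subseteq> K \<longleftrightarrow> {x. \<phi> x \<noteq> 0} \<subseteq> K"
    unfolding supp_def by (metis closure_minimal closure_subset subset_trans)
  then show ?thesis by auto
qed

lemma test_functions_iff:
  "\<phi> \<in> test_functions \<longleftrightarrow> smooth \<phi> \<and> (\<exists>R. \<forall>x. R < norm x \<longrightarrow> \<phi> x = 0)"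
proof -
  have "compact (supp \<phi>) \<longleftrightarrow> (\<exists>R. supp \<phi> \<subseteq> cball 0 R)"
    by (auto simp: compact_eq_bounded_closed supp_def bounded_iff subset_iff)
  then show ?thesis
    unfolding test_functions_def by (simp add: supp_subset_iff not_le)
qed

lemma test_functions_imp_Cc: "\<phi> \<in> test_functions \<Longrightarrow> \<phi> \<in> Cc"
  by (auto simp: test_functions_iff Cc_def smooth_continuous_on)

lemma partial_eq_0:
  assumes "open U" "\<And>x. x \<in> U \<Longrightarrow> f x = 0" "x \<in> U"
  shows "partial i f x = 0"
proof -
  have "(f has_derivative (\<lambda>h. 0)) (at x)"
    by (rule has_derivative_transform_within_open[OF has_derivative_const assms(1,3)])
       (use assms(2) in auto)
  from partial_eqI[OF this] show ?thesis .
qed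

lemma foldr_partial_eq_0:
  assumes "open U" "\<And>x. x \<in> U \<Longrightarrow> f x = 0" "x \<in> U"
  shows "foldr partial is f x = 0"
  using assms(3)
proof (induction "is" arbitrary: x)
  case (Cons i "is")
  then show ?case using partial_eq_0[OF assms(1), of "foldr partial is f"] by simp
qed (use assms in simp)

lemma foldr_partial_test_functions:
  assumes "\<phi> \<in> test_functions"
  shows "foldr partial is \<phi> \<in> test_functions"
proof -
  obtain R where R: "smooth \<phi>" "\<And>x. R < norm x \<Longrightarrow> \<phi> x = 0"
    using assms unfolding test_functions_iff by blast
  have "foldr partial is \<phi> x = 0" if "R < norm x" for x
    by (rule foldr_partial_eq_0[of "{x. R < norm x}"])
       (use that R in \<open>auto intro: open_Collect_less continuous_intros\<close>)
  then show ?thesis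
    using R(1) unfolding test_functions_iff by (blast intro: smooth_foldr_partial)
qed

lemma partial_test_functions: "\<phi> \<in> test_functions \<Longrightarrow> partial i \<phi> \<in> test_functions"
  using foldr_partial_test_functions[of \<phi> "[i]"] by simp

lemma has_vector_derivative_partial_test:
  "\<phi> \<in> test_functions \<Longrightarrow>
    ((\<lambda>t. \<phi> (x + t *\<^sub>R axis i 1)) has_vector_derivative partial i \<phi> x) (at 0)"
  by (intro has_vector_derivative_partial smooth_differentiable) (simp add: test_functions_iff)

lemma laplace_partial:
  assumes "\<phi> \<in> test_functions"
  shows "laplace (partial i \<phi>) a = - of_real (vec_nth a i) * laplace \<phi> a"
  using laplace_directional_derivative[OF test_functions_imp_Cc[OF assms]
      test_functions_imp_Cc[OF partial_test_functions[OF assms]]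
      has_vector_derivative_partial_test[OF assms], of i a]
  by (simp add: inner_axis)

lemma laplace_foldr_partial:
  assumes "\<phi> \<in> test_functions"
  shows "laplace (foldr partial is \<phi>) a = (\<Prod>i\<leftarrow>is. - of_real (vec_nth a i)) * laplace \<phi> a"
  by (induction "is") (simp_all add: laplace_partial foldr_partial_test_functions assms)

lemma Cc_eqI:
  assumes "g \<in> Cc" "h \<in> Cc" "\<And>a. laplace g a = laplace h a"
  shows "g = h"
proof
  fix x
  have "g x + (- 1) * h x = 0"
    by (rule eq_0_if_laplace_eq_0[of "\<lambda>x. g x + (- 1) * h x"])
       (use assms in \<open>simp_all only: laplace_add laplace_cmult Cc_add Cc_cmult, simp\<close>)
  then show "g x = h x" by simp
qed

text \<open>Mixed partial derivatives commute because they have the same transform.\<close>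

lemma foldr_partial_commute:
  assumes "\<phi> \<in> test_functions"
  shows "foldr partial is (partial i \<phi>) = partial i (foldr partial is \<phi>)"
  by (rule Cc_eqI)
     (use assms in \<open>simp_all add: test_functions_imp_Cc foldr_partial_test_functions
       partial_test_functions laplace_foldr_partial laplace_partial\<close>)

text \<open>Justifies the choice in \<open>multi_partial\<close>: as \<open>\<alpha>\<close> has
  finite support it is the multiplicity function of a multiset, and every multiset can be
  listed.\<close>

lemma multi_partial_foldr:
  obtains "is" where "count_list is = Poly_Mapping.lookup \<alpha>"
    "\<And>f. multi_partial \<alpha> f = foldr partial is f"
proof -
  obtain xs where "mset xs = Abs_multiset (Poly_Mapping.lookup \<alpha>)"
    using ex_mset by blast
  moreover have "finite {i. 0 < Poly_Mapping.lookup \<alpha> i}"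
    by simp
  ultimately have "count (mset xs) = Poly_Mapping.lookup \<alpha>"
    by (simp add: count_Abs_multiset)
  then have "count_list xs = Poly_Mapping.lookup \<alpha>"
    by (simp add: fun_eq_iff count_mset)
  then have "count_list (SOME is. count_list is = Poly_Mapping.lookup \<alpha>) = Poly_Mapping.lookup \<alpha>"
    by (rule someI)
  then show ?thesis
    by (rule that) (rule multi_partial_def)
qed

lemma prod_list_eq_monom_eval:
  fixes \<alpha> :: "'n::finite \<Rightarrow>\<^sub>0 nat"
  assumes "count_list is = Poly_Mapping.lookup \<alpha>"
  shows "(\<Prod>i\<leftarrow>is. x i) = monom_eval \<alpha> x"
proof -
  have "(\<Prod>i\<leftarrow>is. x i) = (\<Prod>i\<in>UNIV. x i ^ count_list is i)"
  proof (induction "is")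
    case (Cons j "is")
    have "(\<Prod>i\<in>UNIV. x i ^ count_list (j # is) i) =
        (\<Prod>i\<in>UNIV. (if i = j then x i else 1) * x i ^ count_list is i)"
      by (rule prod.cong) auto
    then show ?case
      using Cons by (simp add: prod.distrib)
  qed simp
  then show ?thesis
    by (simp add: assms monom_eval_UNIV)
qed

lemma multi_partial_test_functions:
  "\<phi> \<in> test_functions \<Longrightarrow> multi_partial \<alpha> \<phi> \<in> test_functions"
  unfolding multi_partial_def by (rule foldr_partial_test_functions)

lemma laplace_multi_partial:
  assumes "\<phi> \<in> test_functions"
  shows "laplace (multi_partial \<alpha> \<phi>) a = monom_eval \<alpha> (\<lambda>i. - of_real (vec_nth a i)) * laplace \<phi> a"
proof -
  obtain "is" where "count_list is = Poly_Mapping.lookup \<alpha>"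
    "\<And>f. multi_partial \<alpha> f = foldr partial is f"
    using multi_partial_foldr[of \<alpha>] by blast
  then show ?thesis
    using assms by (simp add: laplace_foldr_partial prod_list_eq_monom_eval)
qed

lemma test_functions_lincomb:
  assumes "\<phi> \<in> test_functions" "\<psi> \<in> test_functions"
  shows "(\<lambda>x. c * \<phi> x + \<psi> x) \<in> test_functions"
  using assms Cc_add[OF Cc_cmult[OF test_functions_imp_Cc[OF assms(1)]] test_functions_imp_Cc[OF assms(2)]]
  by (auto simp: test_functions_iff smooth_lincomb Cc_def)

lemma test_functions_translate:
  assumes "\<phi> \<in> test_functions"
  shows "(\<lambda>y. \<phi> (y - x)) \<in> test_functions"
  using assms Cc_translate[OF test_functions_imp_Cc[OF assms], of "- x"]
  by (auto simp: test_functions_iff smooth_translate Cc_def)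

section \<open>Regularization of distributions\<close>

lemma distribution_lincomb:
  assumes "u \<in> distributions" "\<phi> \<in> test_functions" "\<psi> \<in> test_functions"
  shows "u (\<lambda>x. c * \<phi> x + \<psi> x) = c * u \<phi> + u \<psi>"
proof -
  have "(\<lambda>x. 0) \<in> test_functions"
    by (auto simp: test_functions_iff smooth_def)
  then have "(\<lambda>x. c * \<phi> x) \<in> test_functions"
    using test_functions_lincomb[OF assms(2), of "\<lambda>x. 0" c] by simp
  then show ?thesis
    using assms unfolding distributions_def by auto
qed

text \<open>Continuity of \<open>u\<close> along a filter. The seminorm estimate for the common
  compact set \<open>K\<close> involves only the finitely many derivatives of order at most
  \<open>N\<close>.\<close>

lemma distribution_tendsto_0:
  assumes u: "u \<in> distributions"
    and ev: "\<forall>\<^sub>F t in F. \<phi> t \<in> test_functions \<and> supp (\<phi> t) \<subseteq> K" and K: "compact K"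
    and lim: "\<And>is. uniform_limit UNIV (\<lambda>t. foldr partial is (\<phi> t)) (\<lambda>x. 0) F"
  shows "((\<lambda>t. u (\<phi> t)) \<longlongrightarrow> 0) F"
proof -
  have "\<exists>C N. \<forall>\<phi>\<in>test_functions. supp \<phi> \<subseteq> K \<longrightarrow>
      cmod (u \<phi>) \<le> C * (\<Sum>\<alpha> | mi_degree \<alpha> \<le> N. SUP x. cmod (multi_partial \<alpha> \<phi> x))"
    using u K unfolding distributions_def by blast
  then obtain C N where CN: "\<And>\<phi>. \<lbrakk>\<phi> \<in> test_functions; supp \<phi> \<subseteq> K\<rbrakk> \<Longrightarrow>
      cmod (u \<phi>) \<le> C * (\<Sum>\<alpha> | mi_degree \<alpha> \<le> N. SUP x. cmod (multi_partial \<alpha> \<phi> x))"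
    by blast
  define n where "n = card {\<alpha> :: 'a \<Rightarrow>\<^sub>0 nat. mi_degree \<alpha> \<le> N}"
  show ?thesis
  proof (rule tendstoI)
    fix e :: real assume e: "e > 0"
    \<comment> \<open>\<open>n\<close> is the number of terms in the seminorm. The constant
      \<open>C\<close> may be negative, hence the absolute value; the added 1 keeps the denominator
      positive and the final inequality strict.\<close>
    define \<delta> where "\<delta> = e / (\<bar>C\<bar> * n + 1)"
    have pos: "\<bar>C\<bar> * n + 1 > 0"
      by (simp add: add_nonneg_pos)
    then have \<delta>: "\<delta> > 0"
      using e by (simp add: \<delta>_def)
    have "\<forall>\<^sub>F t in F. \<forall>x\<in>UNIV. dist (multi_partial \<alpha> (\<phi> t) x) 0 < \<delta>" for \<alpha>
      using lim \<delta> unfolding multi_partial_def uniform_limit_iff by blast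
    then have "\<forall>\<^sub>F t in F. \<forall>\<alpha>\<in>{\<alpha>. mi_degree \<alpha> \<le> N}. \<forall>x\<in>UNIV. dist (multi_partial \<alpha> (\<phi> t) x) 0 < \<delta>"
      using finite_mi_degree_le by (intro eventually_ball_finite) auto
    with ev show "\<forall>\<^sub>F t in F. dist (u (\<phi> t)) 0 < e"
    proof eventually_elim
      case (elim t)
      let ?S = "\<lambda>\<alpha>. SUP x. cmod (multi_partial \<alpha> (\<phi> t) x)"
      have S: "?S \<alpha> \<le> \<delta>" "0 \<le> ?S \<alpha>" if "mi_degree \<alpha> \<le> N" for \<alpha>
      proof -
        have le: "cmod (multi_partial \<alpha> (\<phi> t) x) \<le> \<delta>" for x
          using elim that by (auto simp: less_imp_le)
        then show "?S \<alpha> \<le> \<delta>"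
          by (intro cSUP_least) auto
        \<comment> \<open>Without an upper bound the real \<open>SUP\<close> would be unspecified,
          and its nonnegativity could not be read off from a single value.\<close>
        have "bdd_above (range (\<lambda>x. cmod (multi_partial \<alpha> (\<phi> t) x)))"
          by (rule bdd_aboveI2[OF le])
        then show "0 \<le> ?S \<alpha>"
          by (meson UNIV_I cSUP_upper norm_ge_zero order_trans)
      qed
      have "cmod (u (\<phi> t)) \<le> C * (\<Sum>\<alpha> | mi_degree \<alpha> \<le> N. ?S \<alpha>)"
        using elim by (intro CN) auto
      also have "\<dots> \<le> \<bar>C\<bar> * (\<Sum>\<alpha> | mi_degree \<alpha> \<le> N. ?S \<alpha>)"
        using S by (intro mult_right_mono sum_nonneg) auto
      also have "\<dots> \<le> \<bar>C\<bar> * (n * \<delta>)"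
        using S(1) unfolding n_def by (intro mult_left_mono sum_bounded_above) auto
      also have "\<dots> < (\<bar>C\<bar> * n + 1) * \<delta>"
        using \<delta> by (simp add: algebra_simps)
      also have "\<dots> = e"
        using pos by (simp add: \<delta>_def)
      finally show ?case by simp
    qed
  qed
qed

text \<open>The convolution of \<open>u\<close> with the reflection of \<open>\<phi>\<close>. In
  this form its value at 0 is \<open>u \<phi>\<close>, at the price of a sign when it is
  differentiated in \<open>x\<close>.\<close>

definition conv :: "((real^'n::finite \<Rightarrow> complex) \<Rightarrow> complex) \<Rightarrow> (real^'n \<Rightarrow> complex) \<Rightarrow> real^'n \<Rightarrow> complex" where
  "conv u \<phi> x = u (\<lambda>y. \<phi> (y - x))"

lemma translate_eq_0:
  fixes \<phi> :: "'a::real_normed_vector \<Rightarrow> complex"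
  assumes "\<And>x. R < norm x \<Longrightarrow> \<phi> x = 0" "norm x \<le> M" "M + R < norm y"
  shows "\<phi> (y - x) = 0"
  using assms norm_triangle_sub[of y x] by (intro assms(1)) simp

text \<open>All derivatives of \<open>\<phi>\<close> are uniformly continuous, so the difference of
  two translates tends to 0 with all its derivatives as the shifts approach each other.\<close>

lemma continuous_conv:
  assumes u: "u \<in> distributions" and \<phi>: "\<phi> \<in> test_functions"
  shows "continuous_on UNIV (conv u \<phi>)"
proof (intro continuous_at_imp_continuous_on ballI)
  fix x
  obtain R where R: "smooth \<phi>" "\<And>x. R < norm x \<Longrightarrow> \<phi> x = 0"
    using \<phi> unfolding test_functions_iff by blast
  let ?d = "\<lambda>t y. (- 1) * \<phi> (y - x) + \<phi> (y - t)"
  have d: "?d t \<in> test_functions" for t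
    using \<phi> by (intro test_functions_lincomb test_functions_translate)
  have "((\<lambda>t. u (?d t)) \<longlongrightarrow> 0) (at x)"
  proof (rule distribution_tendsto_0[OF u])
    \<comment> \<open>Bounds every shift \<open>t\<close> within distance 1 of \<open>x\<close>, so
      all the translates concerned are supported in one ball.\<close>
    let ?M = "norm x + 1"
    have "supp (?d t) \<subseteq> cball 0 (?M + R)" if "dist t x < 1" for t
    proof -
      have "norm t \<le> ?M"
        using that norm_triangle_sub[of t x] by (simp add: dist_norm)
      then show ?thesis
        using translate_eq_0[of R \<phi> x ?M, OF R(2)] translate_eq_0[of R \<phi> t ?M, OF R(2)]
        by (auto simp: supp_subset_iff)
    qed
    then show "\<forall>\<^sub>F t in at x. ?d t \<in> test_functions \<and> supp (?d t) \<subseteq> cball 0 (?M + R)"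
      unfolding eventually_at using d by (intro exI[of _ 1]) auto
    show "compact (cball (0::real^'a) (?M + R))" by simp
    fix "is"
    let ?\<psi> = "foldr partial is \<phi>"
    have eq: "foldr partial is (?d t) = (\<lambda>y. (- 1) * ?\<psi> (y - x) + ?\<psi> (y - t))" for t
      by (simp only: foldr_partial_lincomb[OF smooth_translate[OF R(1)] smooth_translate[OF R(1)]]
          foldr_partial_translate[OF R(1)])
    have "uniformly_continuous_on UNIV ?\<psi>"
      using \<phi> by (intro uniformly_continuous_Cc test_functions_imp_Cc foldr_partial_test_functions)
    note uc = this[unfolded uniformly_continuous_on_def]
    show "uniform_limit UNIV (\<lambda>t. foldr partial is (?d t)) (\<lambda>y. 0) (at x)"
      unfolding uniform_limit_iff eq
    proof (intro allI impI)
      fix e :: real assume "e > 0"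
      then obtain \<delta> where \<delta>: "\<delta> > 0" "\<And>y z. dist y z < \<delta> \<Longrightarrow> dist (?\<psi> y) (?\<psi> z) < e"
        using uc by blast
      have "dist ((- 1) * ?\<psi> (y - x) + ?\<psi> (y - t)) 0 < e" if "dist t x < \<delta>" for y t
        using \<delta>(2)[of "y - t" "y - x"] that by (simp add: dist_norm norm_minus_commute)
      then show "\<forall>\<^sub>F t in at x. \<forall>y\<in>UNIV. dist ((- 1) * ?\<psi> (y - x) + ?\<psi> (y - t)) 0 < e"
        unfolding eventually_at using \<delta>(1) by blast
    qed
  qed
  moreover have "u (?d t) = conv u \<phi> t - conv u \<phi> x" for t
    using distribution_lincomb[OF u test_functions_translate[OF \<phi>] test_functions_translate[OF \<phi>], of "- 1" x t]
    by (simp add: conv_def)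
  ultimately show "isCont (conv u \<phi>) x"
    unfolding isCont_def by (subst Lim_null) simp
qed

text \<open>The difference quotients of the translates converge, with all derivatives, to minus the
  translate of \<open>partial i \<phi>\<close>; applying \<open>u\<close> gives the claim.\<close>

lemma conv_directional_derivative:
  assumes u: "u \<in> distributions" and \<phi>: "\<phi> \<in> test_functions"
  shows "((\<lambda>t. conv u \<phi> (x + t *\<^sub>R axis i 1)) has_vector_derivative - conv u (partial i \<phi>) x) (at 0)"
proof -
  let ?e = "axis i 1 :: real^'a"
  obtain R where R: "smooth \<phi>" "\<And>x. R < norm x \<Longrightarrow> \<phi> x = 0"
    using \<phi> unfolding test_functions_iff by blast
  let ?p = "partial i \<phi>"
  have p: "?p \<in> test_functions"
    using \<phi> by (rule partial_test_functions)
  then have p': "smooth ?p"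
    by (simp add: test_functions_iff)
  have pR: "?p x = 0" if "R < norm x" for x
    by (rule partial_eq_0[of "{x. R < norm x}"])
       (use that R in \<open>auto intro: open_Collect_less continuous_intros\<close>)
  \<comment> \<open>The difference quotient of the translates minus its expected limit, arranged as
    nested linear combinations so that \<open>distribution_lincomb\<close> applies.\<close>
  let ?d = "\<lambda>t y. of_real (inverse t) * ((- 1) * \<phi> (y - x) + \<phi> (y - (x + t *\<^sub>R ?e))) + ?p (y - x)"
  have d: "?d t \<in> test_functions" for t
    using \<phi> p by (intro test_functions_lincomb test_functions_translate)
  have "((\<lambda>t. u (?d t)) \<longlongrightarrow> 0) (at 0)"
  proof (rule distribution_tendsto_0[OF u])
    let ?M = "norm x + 1"
    have "supp (?d t) \<subseteq> cball 0 (?M + R)" if "dist t 0 < 1" for t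
    proof -
      have "norm (t *\<^sub>R ?e) \<le> 1"
        using that by simp
      then have "norm (x + t *\<^sub>R ?e) \<le> ?M"
        using norm_triangle_ineq[of x "t *\<^sub>R ?e"] by linarith
      then show ?thesis
        using translate_eq_0[of R \<phi> x ?M, OF R(2)]
          translate_eq_0[of R ?p x ?M, OF pR]
          translate_eq_0[of R \<phi> "x + t *\<^sub>R ?e" ?M, OF R(2)]
        by (auto simp: supp_subset_iff)
    qed
    then show "\<forall>\<^sub>F t in at 0. ?d t \<in> test_functions \<and> supp (?d t) \<subseteq> cball 0 (?M + R)"
      unfolding eventually_at using d by (intro exI[of _ 1]) auto
    show "compact (cball (0::real^'a) (?M + R))" by simp
    fix "is"
    let ?\<psi> = "foldr partial is \<phi>"
    have \<psi>: "?\<psi> \<in> test_functions"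
      using \<phi> by (rule foldr_partial_test_functions)
    \<comment> \<open>Commuting the derivatives makes the last term
      \<open>partial i ?\<psi>\<close>, so the whole expression is the error of a difference
      quotient of \<open>?\<psi>\<close>.\<close>
    have eq: "foldr partial is (?d t) =
        (\<lambda>y. of_real (inverse t) * ((- 1) * ?\<psi> (y - x) + ?\<psi> (y - (x + t *\<^sub>R ?e))) + partial i ?\<psi> (y - x))" for t
      by (simp only: foldr_partial_lincomb smooth_lincomb smooth_translate R(1) p'
          foldr_partial_translate foldr_partial_commute[OF \<phi>])
    \<comment> \<open>The direction is \<open>- ?e\<close>, because increasing the shift moves the
      argument \<open>y - x\<close> backwards.\<close>
    have lim: "uniform_limit UNIV (\<lambda>t z. (?\<psi> (z + t *\<^sub>R (- ?e)) - ?\<psi> z) /\<^sub>R t) (\<lambda>z. - partial i ?\<psi> z) (at 0)"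
    proof (rule uniform_limit_difference_quotient)
      show "((\<lambda>t. ?\<psi> (z + t *\<^sub>R (- ?e))) has_vector_derivative - partial i ?\<psi> z) (at 0)" for z
      proof -
        have 1: "((\<lambda>t::real. - t) has_vector_derivative - 1) (at 0)"
          by (auto intro!: derivative_eq_intros)
        have 2: "((\<lambda>t. ?\<psi> (z + t *\<^sub>R ?e)) has_vector_derivative partial i ?\<psi> z) (at (- 0))"
          using has_vector_derivative_partial_test[OF \<psi>] by simp
        show ?thesis
          using vector_diff_chain_at[OF 1 2] by (simp add: o_def)
      qed
      show "uniformly_continuous_on UNIV (\<lambda>z. - partial i ?\<psi> z)"
        using partial_test_functions[OF \<psi>]
        by (intro uniformly_continuous_on_minus uniformly_continuous_Cc test_functions_imp_Cc)
    qed
    show "uniform_limit UNIV (\<lambda>t. foldr partial is (?d t)) (\<lambda>y. 0) (at 0)"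
      unfolding uniform_limit_iff eq
    proof (intro allI impI)
      fix \<epsilon> :: real assume "\<epsilon> > 0"
      then have "\<forall>\<^sub>F t in at 0. \<forall>z\<in>UNIV. dist ((?\<psi> (z + t *\<^sub>R (- ?e)) - ?\<psi> z) /\<^sub>R t) (- partial i ?\<psi> z) < \<epsilon>"
        using lim unfolding uniform_limit_iff by blast
      then show "\<forall>\<^sub>F t in at 0. \<forall>y\<in>UNIV. dist (of_real (inverse t) *
          ((- 1) * ?\<psi> (y - x) + ?\<psi> (y - (x + t *\<^sub>R ?e))) + partial i ?\<psi> (y - x)) 0 < \<epsilon>"
      proof eventually_elim
        case (elim t)
        show ?case
        proof
          fix y
          have "y - (x + t *\<^sub>R ?e) = (y - x) + t *\<^sub>R (- ?e)"
            by simp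
          then show "dist (of_real (inverse t) *
              ((- 1) * ?\<psi> (y - x) + ?\<psi> (y - (x + t *\<^sub>R ?e))) + partial i ?\<psi> (y - x)) 0 < \<epsilon>"
            using bspec[OF elim, of "y - x"] by (simp add: dist_norm scaleR_conv_of_real diff_diff_eq)
        qed
      qed
    qed
  qed
  then have lim: "((\<lambda>t. norm (u (?d t))) \<longlongrightarrow> 0) (at 0)"
    by (rule tendsto_norm_zero)
  have ud: "u (?d t) = of_real (inverse t) * (conv u \<phi> (x + t *\<^sub>R ?e) - conv u \<phi> x) + conv u ?p x" for t
  proof -
    have "u (?d t) = of_real (inverse t) * u (\<lambda>y. (- 1) * \<phi> (y - x) + \<phi> (y - (x + t *\<^sub>R ?e))) + conv u ?p x"
      unfolding conv_def
      by (rule distribution_lincomb[OF u test_functions_lincomb[OF test_functions_translate[OF \<phi>]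
            test_functions_translate[OF \<phi>]] test_functions_translate[OF p]])
    also have "u (\<lambda>y. (- 1) * \<phi> (y - x) + \<phi> (y - (x + t *\<^sub>R ?e))) = (- 1) * conv u \<phi> x + conv u \<phi> (x + t *\<^sub>R ?e)"
      unfolding conv_def
      by (rule distribution_lincomb[OF u test_functions_translate[OF \<phi>] test_functions_translate[OF \<phi>]])
    finally show ?thesis by simp
  qed
  have "((\<lambda>t. norm (conv u \<phi> (x + (0 + t) *\<^sub>R ?e) - conv u \<phi> (x + 0 *\<^sub>R ?e) - t *\<^sub>R (- conv u ?p x)) / norm t) \<longlongrightarrow> 0) (at 0)"
  proof (rule Lim_transform_eventually[OF lim])
    show "\<forall>\<^sub>F t in at 0. norm (u (?d t)) =
        norm (conv u \<phi> (x + (0 + t) *\<^sub>R ?e) - conv u \<phi> (x + 0 *\<^sub>R ?e) - t *\<^sub>R (- conv u ?p x)) / norm t"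
      unfolding eventually_at
    proof (intro exI[of _ 1] conjI ballI impI)
      fix t :: real assume "t \<noteq> 0 \<and> dist t 0 < 1"
      then have "conv u \<phi> (x + (0 + t) *\<^sub>R ?e) - conv u \<phi> (x + 0 *\<^sub>R ?e) - t *\<^sub>R (- conv u ?p x) = of_real t * u (?d t)"
        unfolding ud by (simp add: field_simps scaleR_conv_of_real)
      then show "norm (u (?d t)) =
        norm (conv u \<phi> (x + (0 + t) *\<^sub>R ?e) - conv u \<phi> (x + 0 *\<^sub>R ?e) - t *\<^sub>R (- conv u ?p x)) / norm t"
        using \<open>t \<noteq> 0 \<and> dist t 0 < 1\<close> by (simp add: norm_mult)
    qed simp
  qed
  then show ?thesis
    unfolding has_vector_derivative_def has_derivative_at
    by (simp add: bounded_linear_minus bounded_linear_scaleR_left)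
qed

definition compactly_supported :: "((real^'n::finite \<Rightarrow> complex) \<Rightarrow> complex) \<Rightarrow> bool" where
  "compactly_supported u \<longleftrightarrow> (\<exists>R. \<forall>\<phi>\<in>test_functions. supp \<phi> \<subseteq> {x. R \<le> norm x} \<longrightarrow> u \<phi> = 0)"

lemma conv_Cc:
  assumes u: "u \<in> distributions" "compactly_supported u" and \<phi>: "\<phi> \<in> test_functions"
  shows "conv u \<phi> \<in> Cc"
proof -
  obtain S where S: "\<And>\<phi>. \<phi> \<in> test_functions \<Longrightarrow> supp \<phi> \<subseteq> {x. S \<le> norm x} \<Longrightarrow> u \<phi> = 0"
    using u(2) unfolding compactly_supported_def by blast
  obtain R where R: "\<And>x. R < norm x \<Longrightarrow> \<phi> x = 0"
    using \<phi> unfolding test_functions_iff by blast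
  \<comment> \<open>For such \<open>x\<close>, a point of norm below \<open>S\<close> is farther
    than \<open>R\<close> from \<open>x\<close>, so the translate of \<open>\<phi>\<close> vanishes
    there and \<open>u\<close> does not see it.\<close>
  have "conv u \<phi> x = 0" if "R + S < norm x" for x
    unfolding conv_def
  proof (rule S)
    show "(\<lambda>y. \<phi> (y - x)) \<in> test_functions"
      using \<phi> by (rule test_functions_translate)
    have "closed {y::real^'a. S \<le> norm y}"
      by (intro closed_Collect_le continuous_intros)
    moreover have "\<phi> (y - x) = 0" if "norm y < S" for y
      using \<open>R + S < norm x\<close> that norm_triangle_sub[of x y]
      by (intro R) (simp add: norm_minus_commute)
    ultimately show "supp (\<lambda>y. \<phi> (y - x)) \<subseteq> {y. S \<le> norm y}"
      by (simp add: supp_subset_iff)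
  qed
  then show ?thesis
    unfolding Cc_def using continuous_conv[OF u(1) \<phi>] by blast
qed

text \<open>Two signs cancel for each derivative, one from differentiating \<open>conv\<close> in
  \<open>x\<close> and one from the transform. Hence the monomial is taken at \<open>a\<close>, in
  contrast to \<open>laplace_multi_partial\<close>.\<close>

lemma laplace_conv_multi_partial:
  assumes u: "u \<in> distributions" "compactly_supported u" and \<phi>: "\<phi> \<in> test_functions"
  shows "laplace (conv u (multi_partial \<alpha> \<phi>)) a =
    monom_eval \<alpha> (\<lambda>i. of_real (vec_nth a i)) * laplace (conv u \<phi>) a"
proof -
  have partial: "laplace (conv u (partial i \<psi>)) a = of_real (vec_nth a i) * laplace (conv u \<psi>) a"
    if \<psi>: "\<psi> \<in> test_functions" for \<psi> i
  proof -
    have p: "conv u (partial i \<psi>) \<in> Cc"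
      by (intro conv_Cc u partial_test_functions \<psi>)
    have "laplace (\<lambda>x. (- 1) * conv u (partial i \<psi>) x) a = - of_real (inner a (axis i 1)) * laplace (conv u \<psi>) a"
    proof (rule laplace_directional_derivative)
      show "conv u \<psi> \<in> Cc" by (intro conv_Cc u \<psi>)
      show "(\<lambda>x. (- 1) * conv u (partial i \<psi>) x) \<in> Cc"
        by (rule Cc_cmult[OF p])
      show "((\<lambda>t. conv u \<psi> (x + t *\<^sub>R axis i 1)) has_vector_derivative (- 1) * conv u (partial i \<psi>) x) (at 0)" for x
        using conv_directional_derivative[OF u(1) \<psi>] by simp
    qed
    then show ?thesis
      unfolding laplace_cmult by (simp add: inner_axis)
  qed
  have list: "laplace (conv u (foldr partial is \<phi>)) a = (\<Prod>i\<leftarrow>is. of_real (vec_nth a i)) * laplace (conv u \<phi>) a" for "is"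
    by (induction "is") (simp_all add: partial foldr_partial_test_functions \<phi>)
  obtain "is" where "count_list is = Poly_Mapping.lookup \<alpha>"
    "\<And>f. multi_partial \<alpha> f = foldr partial is f"
    using multi_partial_foldr[of \<alpha>] by blast
  then show ?thesis
    using list by (simp add: prod_list_eq_monom_eval)
qed

section \<open>Uncontrollable behaviors\<close>

text \<open>The common core of both cases: \<open>G\<close> is the compactly supported signal for
  smooth functions, and the family of its regularizations for distributions.\<close>

lemma eq_0_if_kernel_laplace:
  fixes P :: "'n::finite diffop mat" and G :: "nat \<Rightarrow> real^'n \<Rightarrow> complex"
  assumes P: "P \<in> carrier_mat l k" "minor_ideal k P \<noteq> {0}"
    and G: "\<And>j. j < k \<Longrightarrow> G j \<in> Cc"
    and ker: "\<And>i a. i < l \<Longrightarrow>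
      (\<Sum>j<k. mpoly_eval (P $$ (i, j)) (\<lambda>v. - of_real (vec_nth a v)) * laplace (G j) a) = 0"
    and j: "j < k"
  shows "G j x = 0"
proof -
  obtain M where M: "M \<in> minors k P" "M \<noteq> 0"
    using P(2) unfolding minor_ideal_eq_0_iff by blast
  have nz: "laplace (G j) a = 0" if "mpoly_eval M (\<lambda>v. - of_real (vec_nth a v)) \<noteq> 0" for a
  proof (rule kernel_trivial_if_minor_nonzero)
    let ?h = "\<lambda>q. mpoly_eval q (\<lambda>v. - of_real (vec_nth a v))"
    show "map_mat ?h P \<in> carrier_mat l k"
      using P(1) by simp
    show "?h M \<in> minors k (map_mat ?h P)"
      using M(1) det_submatrix_mpoly_eval[symmetric] unfolding minors_def by fastforce
    show "?h M \<noteq> 0" by fact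
    show "(\<Sum>j<k. map_mat ?h P $$ (i, j) * laplace (G j) a) = 0" if "i < l" for i
      using ker[OF that, of a] P(1) that by simp
  qed fact
  have "laplace (G j) a = 0" for a
  proof -
    \<comment> \<open>The sequence approaches \<open>- a\<close> because the minor is evaluated at
      the negative of the parameter of the transform.\<close>
    obtain b where b: "b \<longlonglongrightarrow> - a" "\<And>n. mpoly_eval M (\<lambda>v. of_real (vec_nth (b n) v)) \<noteq> 0"
      using mpoly_nonroots_dense[OF M(2), of "- a"] by blast
    have "laplace (G j) (- b n) = 0" for n
      by (rule nz) (use b(2)[of n] in simp)
    moreover have "(\<lambda>n. laplace (G j) (- b n)) \<longlonglongrightarrow> laplace (G j) a"
      using laplace_tendsto[OF G[OF j] tendsto_minus[OF b(1)]] by simp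
    ultimately show ?thesis
      by (simp add: LIMSEQ_const_iff)
  qed
  then show ?thesis
    by (rule eq_0_if_laplace_eq_0[OF G[OF j]])
qed

lemma sum_fun_apply: "(\<Sum>a\<in>A. f a) x = (\<Sum>a\<in>A. f a x :: 'b::comm_monoid_add)"
  by (induction A rule: infinite_finite_induct) (auto simp: zero_fun_def plus_fun_def)

lemma zero_in_behavior:
  assumes "0 \<in> signals S" "\<And>p. act S p 0 = 0"
  shows "0\<^sub>v (dim_col P) \<in> behavior S P"
  using assms by (simp add: behavior_def)

text \<open>Removes the sub-behavior: the patched signal lies in it, so a contradiction within the
  behavior of \<open>P\<close> suffices. The two sets may depend on \<open>f\<close>, and so on
  where its nonzero component is detected.\<close>

lemma uncontrollableI:
  assumes S: "0 \<in> signals S" "\<And>p. act S p 0 = 0"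
    and key: "\<And>f j. \<lbrakk>f \<in> behavior S P; j < dim_col P; vec_index f j \<noteq> 0\<rbrakk> \<Longrightarrow>
      \<exists>U1 U2. closure U1 \<inter> closure U2 = {} \<and>
        (\<forall>g\<in>behavior S P. equal_near S U1 g f \<longrightarrow> \<not> equal_near S U2 g (0\<^sub>v (dim_col P)))"
  shows "uncontrollable S (dim_col P) (behavior S P)"
  unfolding uncontrollable_def
proof
  assume "\<exists>C. is_behavior S (dim_col P) C \<and> C \<subseteq> behavior S P \<and> C \<noteq> {0\<^sub>v (dim_col P)} \<and> controllable S C"
  then obtain C where C: "is_behavior S (dim_col P) C" "C \<subseteq> behavior S P"
    "C \<noteq> {0\<^sub>v (dim_col P)}" "controllable S C"
    by blast
  have 0: "0\<^sub>v (dim_col P) \<in> C"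
    using C(1) zero_in_behavior[OF S] unfolding is_behavior_def by metis
  then obtain f where f: "f \<in> C" "f \<noteq> 0\<^sub>v (dim_col P)"
    using C(3) by blast
  then have "f \<in> carrier_vec (dim_col P)"
    using C(2) by (auto simp: behavior_def)
  then obtain j where j: "j < dim_col P" "vec_index f j \<noteq> 0"
    using f(2) by (metis carrier_vecD eq_vecI index_zero_vec)
  obtain U1 U2 where U: "closure U1 \<inter> closure U2 = {}"
    "\<And>g. g \<in> behavior S P \<Longrightarrow> equal_near S U1 g f \<Longrightarrow> \<not> equal_near S U2 g (0\<^sub>v (dim_col P))"
    using key[OF _ j] f(1) C(2) by blast
  then obtain g where "g \<in> C" "equal_near S U1 g f" "equal_near S U2 g (0\<^sub>v (dim_col P))"
    using C(4) f(1) 0 unfolding controllable_def by blast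
  then show False
    using U(2) C(2) by blast
qed

lemma uncontrollable_smooth:
  fixes P :: "'n::finite diffop mat"
  assumes P: "minor_ideal (dim_col P) P \<noteq> {0}"
  shows "uncontrollable smooth_space (dim_col P) (behavior smooth_space P)"
proof (rule uncontrollableI)
  show "0 \<in> signals smooth_space"
    by (simp add: smooth_space_def smooth_def zero_fun_def)
  show "act smooth_space p 0 = 0" for p :: "'n diffop"
    by (simp add: smooth_space_def multi_partial_def zero_fun_def)
  fix f :: "(real^'n \<Rightarrow> complex) Matrix.vec" and j
  let ?k = "dim_col P"
  assume f: "f \<in> behavior smooth_space P" and j: "j < ?k" and fj: "vec_index f j \<noteq> 0"
  obtain x0 where x0: "vec_index f j x0 \<noteq> 0"
    using fj by (auto simp: fun_eq_iff zero_fun_def)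
  \<comment> \<open>The first set is the single point \<open>x0\<close>, where \<open>f\<close> is
    seen to be nonzero. Being 0 near this exterior gives the patched signal compact support, and the
    gap of 1 keeps the closures disjoint.\<close>
  let ?U2 = "{x :: real^'n. norm x0 + 1 \<le> norm x}"
  have "closed ?U2"
    by (intro closed_Collect_le continuous_intros)
  then have "closure {x0} \<inter> closure ?U2 = {}"
    by (simp add: closure_closed)
  moreover have False
    if g: "g \<in> behavior smooth_space P" "equal_near smooth_space {x0} g f"
      "equal_near smooth_space ?U2 g (0\<^sub>v ?k)" for g
  proof -
    let ?g = "vec_index g"
    have gk: "dim_vec g = ?k"
      using g(1) by (auto simp: behavior_def)
    have test: "?g j \<in> test_functions" if "j < ?k" for j
    proof -
      obtain V where V: "?U2 \<subseteq> V" "agree smooth_space V (?g j) (vec_index (0\<^sub>v ?k) j)"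
        using g(3) \<open>j < ?k\<close> unfolding equal_near_def gk by blast
      have "?g j x = 0" if "norm x0 + 1 < norm x" for x
      proof -
        have "\<forall>x\<in>V. ?g j x = 0"
          using V(2) \<open>j < ?k\<close> by (simp add: smooth_space_def zero_fun_def)
        moreover have "x \<in> V"
          using that by (intro subsetD[OF V(1)]) simp
        ultimately show ?thesis by blast
      qed
      moreover have "smooth (?g j)"
        using g(1) that by (auto simp: behavior_def smooth_space_def)
      ultimately show ?thesis
        unfolding test_functions_iff by blast
    qed
    have "?g j x0 = 0"
    proof (rule eq_0_if_kernel_laplace[where G = ?g and P = P and k = ?k and l = "dim_row P"])
      show "P \<in> carrier_mat (dim_row P) ?k" by auto
      show "?g j \<in> Cc" if "j < ?k" for j
        by (rule test_functions_imp_Cc[OF test[OF that]])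
      fix i a assume i: "i < dim_row P"
      let ?t = "\<lambda>j \<alpha> x. Poly_Mapping.lookup (P $$ (i, j)) \<alpha> * multi_partial \<alpha> (?g j) x"
      have tC: "?t j \<alpha> \<in> Cc" if "j < ?k" for j \<alpha>
        by (intro Cc_cmult test_functions_imp_Cc multi_partial_test_functions test that)
      have "(\<Sum>j<?k. act smooth_space (P $$ (i, j)) (?g j)) = 0"
        using g(1) i by (simp add: behavior_def)
      then have "(\<lambda>x. \<Sum>j<?k. \<Sum>\<alpha>\<in>Poly_Mapping.keys (P $$ (i, j)). ?t j \<alpha> x) = (\<lambda>x. 0)"
        by (simp add: smooth_space_def fun_eq_iff sum_fun_apply zero_fun_def)
      then have "0 = laplace (\<lambda>x. \<Sum>j<?k. \<Sum>\<alpha>\<in>Poly_Mapping.keys (P $$ (i, j)). ?t j \<alpha> x) a"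
        by simp
      also have "\<dots> = (\<Sum>j<?k. laplace (\<lambda>x. \<Sum>\<alpha>\<in>Poly_Mapping.keys (P $$ (i, j)). ?t j \<alpha> x) a)"
        by (intro laplace_sum tC) auto
      also have "\<dots> = (\<Sum>j<?k. \<Sum>\<alpha>\<in>Poly_Mapping.keys (P $$ (i, j)). laplace (?t j \<alpha>) a)"
        by (intro sum.cong refl laplace_sum tC) auto
      also have "\<dots> = (\<Sum>j<?k. mpoly_eval (P $$ (i, j)) (\<lambda>v. - of_real (vec_nth a v)) * laplace (?g j) a)"
        using test
        by (intro sum.cong refl)
           (simp add: laplace_cmult laplace_multi_partial mpoly_eval_def sum_distrib_right mult.assoc)
      finally show "(\<Sum>j<?k. mpoly_eval (P $$ (i, j)) (\<lambda>v. - of_real (vec_nth a v)) * laplace (?g j) a) = 0"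
        by simp
    qed fact+
    moreover have "?g j x0 = vec_index f j x0"
      using g(2) j unfolding equal_near_def gk by (auto simp: smooth_space_def)
    ultimately show False
      using x0 by simp
  qed
  ultimately show "\<exists>U1 U2. closure U1 \<inter> closure U2 = {} \<and>
      (\<forall>g\<in>behavior smooth_space P. equal_near smooth_space U1 g f \<longrightarrow>
        \<not> equal_near smooth_space U2 g (0\<^sub>v ?k))"
    by blast
qed

text \<open>Absorbs the sign in the action on distributions, so that they lead to the same system
  P(-a) as smooth functions.\<close>

lemma monom_eval_uminus:
  "monom_eval \<alpha> (\<lambda>i. - x i) = (- 1) ^ mi_degree \<alpha> * monom_eval (\<alpha> :: 'n::finite \<Rightarrow>\<^sub>0 nat) x"
proof -
  have "monom_eval \<alpha> (\<lambda>i. - x i) = (\<Prod>i\<in>UNIV. (- 1) ^ Poly_Mapping.lookup \<alpha> i * x i ^ Poly_Mapping.lookup \<alpha> i)"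
    unfolding monom_eval_UNIV by (intro prod.cong refl power_minus)
  then show ?thesis
    by (simp add: monom_eval_UNIV mi_degree_def prod.distrib power_sum)
qed

lemma uncontrollable_distribution:
  fixes P :: "'n::finite diffop mat"
  assumes P: "minor_ideal (dim_col P) P \<noteq> {0}"
  shows "uncontrollable distribution_space (dim_col P) (behavior distribution_space P)"
proof (rule uncontrollableI)
  show "0 \<in> signals distribution_space"
    by (auto simp: distribution_space_def distributions_def zero_fun_def intro!: exI[of _ "0::real"])
  show "act distribution_space p 0 = 0" for p :: "'n diffop"
    by (simp add: distribution_space_def zero_fun_def fun_eq_iff)
  fix f :: "((real^'n \<Rightarrow> complex) \<Rightarrow> complex) Matrix.vec" and j
  let ?k = "dim_col P"
  assume f: "f \<in> behavior distribution_space P" and j: "j < ?k" and fj: "vec_index f j \<noteq> 0"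
  have fd: "vec_index f j \<in> distributions"
    using f j by (simp add: behavior_def distribution_space_def)
  obtain \<phi> where \<phi>0: "vec_index f j \<phi> \<noteq> 0"
    using fj by (auto simp: fun_eq_iff zero_fun_def)
  \<comment> \<open>By convention a distribution is 0 off the test functions, so a nonzero value
    forces this.\<close>
  then have \<phi>: "\<phi> \<in> test_functions"
    using fd unfolding distributions_def by blast
  then obtain R where R: "\<And>x. R < norm x \<Longrightarrow> \<phi> x = 0"
    unfolding test_functions_iff by blast
  \<comment> \<open>\<open>?U1\<close> contains the support of \<open>\<phi>\<close>, so agreement
    with \<open>f\<close> near it preserves the nonzero value at \<open>\<phi>\<close>.
    \<open>?U2\<close> starts one unit further out and bounds the support of the patched
    signal.\<close>
  let ?U1 = "cball (0::real^'n) R" and ?U2 = "{x::real^'n. R + 1 \<le> norm x}"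
  have "closed ?U2"
    by (intro closed_Collect_le continuous_intros)
  then have "closure ?U1 \<inter> closure ?U2 = {}"
    by (auto simp: closure_closed)
  moreover have False
    if g: "g \<in> behavior distribution_space P" "equal_near distribution_space ?U1 g f"
      "equal_near distribution_space ?U2 g (0\<^sub>v ?k)" for g
  proof -
    let ?g = "vec_index g"
    have gk: "dim_vec g = ?k"
      using g(1) by (auto simp: behavior_def)
    have dist: "?g j \<in> distributions" if "j < ?k" for j
      using g(1) that by (simp add: behavior_def distribution_space_def)
    have cs: "compactly_supported (?g j)" if "j < ?k" for j
    proof -
      obtain V where V: "?U2 \<subseteq> V" "agree distribution_space V (?g j) (vec_index (0\<^sub>v ?k) j)"
        using g(3) \<open>j < ?k\<close> unfolding equal_near_def gk by blast
      have "?g j \<psi> = 0" if "\<psi> \<in> test_functions" "supp \<psi> \<subseteq> ?U2" for \<psi>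
      proof -
        have "\<forall>\<psi>\<in>test_functions. supp \<psi> \<subseteq> V \<longrightarrow> ?g j \<psi> = 0"
          using V(2) \<open>j < ?k\<close> by (simp add: distribution_space_def zero_fun_def)
        then show ?thesis
          using that V(1) by (meson subset_trans)
      qed
      then show ?thesis
        unfolding compactly_supported_def by blast
    qed
    have "conv (?g j) \<phi> 0 = 0"
    proof (rule eq_0_if_kernel_laplace[where G = "\<lambda>j. conv (?g j) \<phi>" and P = P and k = ?k and l = "dim_row P"])
      show "P \<in> carrier_mat (dim_row P) ?k" by auto
      show "conv (?g j) \<phi> \<in> Cc" if "j < ?k" for j
        by (rule conv_Cc[OF dist[OF that] cs[OF that] \<phi>])
      fix i a assume i: "i < dim_row P"
      let ?c = "\<lambda>j \<alpha>. Poly_Mapping.lookup (P $$ (i, j)) \<alpha> * (- 1) ^ mi_degree \<alpha>"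
      let ?t = "\<lambda>j \<alpha> x. ?c j \<alpha> * conv (?g j) (multi_partial \<alpha> \<phi>) x"
      have tC: "?t j \<alpha> \<in> Cc" if "j < ?k" for j \<alpha>
        by (intro Cc_cmult conv_Cc dist cs that multi_partial_test_functions \<phi>)
      have "(\<Sum>j<?k. act distribution_space (P $$ (i, j)) (?g j)) = 0"
        using g(1) i by (simp add: behavior_def)
      \<comment> \<open>Testing row \<open>i\<close> against all translates of \<open>\<phi>\<close>
        turns an equation of distributions into an identity between functions of \<open>x\<close>,
        which can be transformed.\<close>
      then have "(\<Sum>j<?k. act distribution_space (P $$ (i, j)) (?g j) (\<lambda>y. \<phi> (y - x))) = 0" for x
        by (simp add: fun_eq_iff sum_fun_apply zero_fun_def)
      moreover have "multi_partial \<alpha> (\<lambda>y. \<phi> (y - x)) = (\<lambda>y. multi_partial \<alpha> \<phi> (y - x))" for \<alpha> x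
        using \<phi> unfolding multi_partial_def by (simp add: foldr_partial_translate test_functions_iff)
      ultimately have "(\<lambda>x. \<Sum>j<?k. \<Sum>\<alpha>\<in>Poly_Mapping.keys (P $$ (i, j)). ?t j \<alpha> x) = (\<lambda>x. 0)"
        by (simp add: distribution_space_def test_functions_translate[OF \<phi>] conv_def)
      then have "0 = laplace (\<lambda>x. \<Sum>j<?k. \<Sum>\<alpha>\<in>Poly_Mapping.keys (P $$ (i, j)). ?t j \<alpha> x) a"
        by simp
      also have "\<dots> = (\<Sum>j<?k. laplace (\<lambda>x. \<Sum>\<alpha>\<in>Poly_Mapping.keys (P $$ (i, j)). ?t j \<alpha> x) a)"
        by (intro laplace_sum tC) auto
      also have "\<dots> = (\<Sum>j<?k. \<Sum>\<alpha>\<in>Poly_Mapping.keys (P $$ (i, j)). laplace (?t j \<alpha>) a)"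
        by (intro sum.cong refl laplace_sum tC) auto
      also have "\<dots> = (\<Sum>j<?k. mpoly_eval (P $$ (i, j)) (\<lambda>v. - of_real (vec_nth a v)) * laplace (conv (?g j) \<phi>) a)"
        using dist cs \<phi>
        by (intro sum.cong refl)
           (simp add: laplace_cmult laplace_conv_multi_partial mpoly_eval_def sum_distrib_right
             monom_eval_uminus mult.assoc)
      finally show "(\<Sum>j<?k. mpoly_eval (P $$ (i, j)) (\<lambda>v. - of_real (vec_nth a v)) * laplace (conv (?g j) \<phi>) a) = 0"
        by simp
    qed fact+
    then have "?g j \<phi> = 0"
      by (simp add: conv_def)
    moreover have "?g j \<phi> = vec_index f j \<phi>"
    proof -
      have "supp \<phi> \<subseteq> ?U1"
        using R by (simp add: supp_subset_iff not_le)
      then show ?thesis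
        using g(2) j \<phi> unfolding equal_near_def gk
        by (auto simp: distribution_space_def dest: subset_trans)
    qed
    ultimately show False
      using \<phi>0 by simp
  qed
  ultimately show "\<exists>U1 U2. closure U1 \<inter> closure U2 = {} \<and>
      (\<forall>g\<in>behavior distribution_space P. equal_near distribution_space U1 g f \<longrightarrow>
        \<not> equal_near distribution_space U2 g (0\<^sub>v ?k))"
    by blast
qed

theorem theorem6p2:
  fixes k :: nat
    and G :: "(nat \<times> 'n::finite diffop mat) set"
    and G_square :: "'n diffop mat set"
  assumes "k \<ge> 1"
    and "G = {(l, P). l \<ge> k \<and> P \<in> carrier_mat l k \<and> minor_ideal k P \<noteq> {0}}"
    and "G_square = {P \<in> carrier_mat k k. minor_ideal k P \<noteq> {0}}"
  shows "(openin (zariski_overdetermined k) G \<and>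
          (\<forall>l\<ge>k. \<exists>P. (l, P) \<in> G) \<and>
          (\<forall>(l, P)\<in>G.
             uncontrollable distribution_space k (behavior distribution_space P) \<and>
             uncontrollable smooth_space k (behavior smooth_space P))) \<and>
         (openin (zariski_matrices k k) G_square \<and>
          G_square \<noteq> {} \<and>
          (\<forall>P\<in>G_square.
             uncontrollable distribution_space k (behavior distribution_space P) \<and>
             uncontrollable smooth_space k (behavior smooth_space P)))"
proof -
  have unc: "uncontrollable distribution_space k (behavior distribution_space P)"
    "uncontrollable smooth_space k (behavior smooth_space P)"
    if "P \<in> carrier_mat l k" "minor_ideal k P \<noteq> {0}" for l and P :: "'n diffop mat"
    using that uncontrollable_distribution[of P] uncontrollable_smooth[of P] by auto
  have ex: "\<exists>P :: 'n diffop mat. P \<in> carrier_mat l k \<and> minor_ideal k P \<noteq> {0}" if "k \<le> l" for l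
    using ex_minor_ideal_nonzero[OF that] by metis
  \<comment> \<open>Openness in the disjoint union is checked on the slices with
    \<open>l \<ge> k\<close>, and these are the sets already known to be open.\<close>
  have "{P. (l, P) \<in> G} = {P \<in> carrier_mat l k. minor_ideal k P \<noteq> {0}}" if "k \<le> l" for l
    using that by (auto simp: assms(2))
  then have "openin (zariski_overdetermined k) G"
    unfolding zariski_overdetermined_def openin_sum_topology
    using openin_minor_ideal_nonzero by (auto simp: assms(2))
  moreover have "\<forall>l\<ge>k. \<exists>P. (l, P) \<in> G"
    using ex by (simp add: assms(2))
  moreover have "G_square \<noteq> {}"
    using ex[of k] by (auto simp: assms(3))
  moreover have "\<forall>(l, P)\<in>G. uncontrollable distribution_space k (behavior distribution_space P) \<and>
      uncontrollable smooth_space k (behavior smooth_space P)"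
    unfolding assms(2) using unc by blast
  moreover have "\<forall>P\<in>G_square. uncontrollable distribution_space k (behavior distribution_space P) \<and>
      uncontrollable smooth_space k (behavior smooth_space P)"
    unfolding assms(3) using unc by blast
  moreover have "openin (zariski_matrices k k) G_square"
    unfolding assms(3) by (rule openin_minor_ideal_nonzero)
  ultimately show ?thesis
    by blast
qed

end
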